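(* Let $h:\mathbb{R}^m\to\mathbb{R}\cup\{+\infty\}$ be piecewise linear-quadratic and convex, let $c:\mathbb{R}^n\to\mathbb{R}^m$ be $C^2$-smooth, and let $f:=h\circ c$. Let $\bar x\in\mathrm{dom}(f)$ be such that the basic constraint qualification $\mathrm{Null}(\nabla c(\bar x)^\top)\cap N(c(\bar x)\,|\,\mathrm{dom}(h))=\{0\}$ holds, and let $\bar y\in\mathbb{R}^m$. Then the following are equivalent: (1) The set $M(\bar x):=\mathrm{Null}(\nabla c(\bar x)^\top)\cap\partial h(c(\bar x))$ is the singleton $\{\bar y\}$, and the second-order sufficient conditions hold at $\bar x$, i.e. $0\in\nabla c(\bar x)^\top\partial h(c(\bar x))$ and $$h''(c(\bar x);\nabla c(\bar x)d)+\max\{\langle d,\nabla^2(yc)(\bar x)d\rangle : y\in M(\bar x)\}>0\quad\text{for all } d\in D(\bar x)\setminus\{0\}.$$ (2) The set-valued mapping $g+G:\mathbb{R}^{n+m}\rightrightarrows\mathbb{R}^{n+m}$ given by $$g(x,y)=\begin{pmatrix}\nabla c(x)^\top y\\ -c(x)\end{pmatrix},\qquad G(x,y)=\begin{pmatrix}\{0\}^n\\ \partial h^\star(y)\end{pmatrix}$$ is strongly metrically subregular at $(\bar x,\bar y)$ for $0$, and $\bar x$ is a strong local minimizer of $f$.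
   Context: A proper function $h:\mathbb{R}^m\to\mathbb{R}\cup\{+\infty\}$ is piecewise linear-quadratic (PLQ) if $\mathrm{dom}(h)=\{c:h(c)<\infty\}$ is nonempty and is the union of finitely many polyhedral sets $C_1,\dots,C_{\mathcal K}$, relative to each of which $h(c)=\frac12\langle c,Q_kc\rangle+\langle b_k,c\rangle+\beta_k$ with $Q_k$ a symmetric matrix, $b_k\in\mathbb{R}^m$, $\beta_k\in\mathbb{R}$. $\partial h$ is the convex subdifferential, $h^\star$ the Fenchel conjugate, $N(\cdot|C)$ the normal cone to the convex set $C$. $\nabla c(x)$ is the $m\times n$ Jacobian, and $(yc)(x):=\langle y,c(x)\rangle$. The one-sided directional derivatives are $h'(c;w)=\lim_{t\searrow0}\frac{h(c+tw)-h(c)}{t}$ and, where $h'(c;w)$ is finite, $h''(c;w)=\lim_{t\searrow 0}\frac{h(c+tw)-h(c)-th'(c;w)}{\frac12t^2}$. (For PLQ convex $h$ these exist for directions in the tangent cone to $\mathrm{dom}(h)$; for $w$ outside the tangent cone $h''(c;w)=+\infty$.) $D(\bar x):=\{d\in\mathbb{R}^n: h'(c(\bar x);\nabla c(\bar x)d)\le 0\}$ is the set of directions of non-ascent. A set-valued mapping $S$ is strongly metrically subregular at $\bar z$ for $\bar w$ if $\bar w\in S(\bar z)$ and there are $\kappa\ge0$ and a neighborhood $U$ of $\bar z$ with $\|z-\bar z\|\le\kappa\,\mathrm{dist}(\bar w\,|\,S(z))$ for all $z\in U$ (distance to the empty set is $+\infty$). $\bar x$ is a strong local minimizer of $f$ if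 there are a neighborhood $U$ of $\bar x$ and $\gamma>0$ with $f(x)\ge f(\bar x)+\gamma\|x-\bar x\|^2$ for all $x\in U\cap\mathrm{dom}(f)$. *)

theory Defs
  imports "HOL-Analysis.Analysis"
begin

definition domain :: "('a \<Rightarrow> ereal) \<Rightarrow> 'a set"
  where "domain h = {c. h c < \<infinity>}"

definition proper :: "('a \<Rightarrow> ereal) \<Rightarrow> bool"
  where "proper h \<longleftrightarrow> (\<forall>c. h c \<noteq> -\<infinity>) \<and> domain h \<noteq> {}"

text \<open>Used only for functions that never take the value \<open>-\<infinity>\<close>, so the sum on the
  right-hand side is never of the form \<open>\<infinity> - \<infinity>\<close>.\<close>

definition econvex :: "('a::real_vector \<Rightarrow> ereal) \<Rightarrow> bool"
  where "econvex h \<longleftrightarrow> (\<forall>a b t. 0 < t \<and> t < 1 \<longrightarrow>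
    h ((1 - t) *\<^sub>R a + t *\<^sub>R b) \<le> ereal (1 - t) * h a + ereal t * h b)"

definition plq :: "(real^'m \<Rightarrow> ereal) \<Rightarrow> bool"
  where "plq h \<longleftrightarrow> proper h \<and>
    (\<exists>(K::nat) (C :: nat \<Rightarrow> (real^'m) set) (Q :: nat \<Rightarrow> real^'m^'m) (b :: nat \<Rightarrow> real^'m) (\<beta> :: nat \<Rightarrow> real).
       domain h = (\<Union>k<K. C k) \<and>
       (\<forall>k<K. polyhedron (C k) \<and> transpose (Q k) = Q k \<and>
          (\<forall>c\<in>C k. h c = ereal (1/2 * (c \<bullet> (Q k *v c)) + b k \<bullet> c + \<beta> k))))"

definition subdifferential :: "('a::real_inner \<Rightarrow> ereal) \<Rightarrow> 'a \<Rightarrow> 'a set"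
  where "subdifferential h c =
    {v. \<bar>h c\<bar> \<noteq> \<infinity> \<and> (\<forall>z. h c + ereal (v \<bullet> (z - c)) \<le> h z)}"

definition conjugate :: "('a::real_inner \<Rightarrow> ereal) \<Rightarrow> 'a \<Rightarrow> ereal"
  where "conjugate h y = (SUP c. ereal (y \<bullet> c) - h c)"

definition normal_cone :: "'a::real_inner \<Rightarrow> 'a set \<Rightarrow> 'a set"
  where "normal_cone c C = {v. c \<in> C \<and> (\<forall>z\<in>C. v \<bullet> (z - c) \<le> 0)}"

definition dir_deriv :: "('a::real_vector \<Rightarrow> ereal) \<Rightarrow> 'a \<Rightarrow> 'a \<Rightarrow> ereal"
  where "dir_deriv h c w =
    Lim (at_right 0) (\<lambda>t::real. (h (c + t *\<^sub>R w) - h c) / ereal t)"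

text \<open>For piecewise linear-quadratic convex \<open>h\<close> and \<open>c\<close> in its domain, the
  first-order directional derivative is infinite exactly for \<open>w\<close> outside the
  tangent cone to the domain, where the second-order one is \<open>\<infinity>\<close> by convention.\<close>

definition dir_deriv2 :: "('a::real_vector \<Rightarrow> ereal) \<Rightarrow> 'a \<Rightarrow> 'a \<Rightarrow> ereal"
  where "dir_deriv2 h c w =
    (if \<bar>dir_deriv h c w\<bar> \<noteq> \<infinity>
     then Lim (at_right 0) (\<lambda>t::real.
            (h (c + t *\<^sub>R w) - h c - ereal t * dir_deriv h c w) / ereal (1/2 * t\<^sup>2))
     else \<infinity>)"

definition C2_smooth :: "('a::real_normed_vector \<Rightarrow> 'b::real_normed_vector) \<Rightarrow> bool"
  where "C2_smooth c \<longleftrightarrow>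
    (\<exists>(c' :: 'a \<Rightarrow> 'a \<Rightarrow>\<^sub>L 'b) (c'' :: 'a \<Rightarrow> 'a \<Rightarrow>\<^sub>L ('a \<Rightarrow>\<^sub>L 'b)).
       (\<forall>x. (c has_derivative blinfun_apply (c' x)) (at x)) \<and>
       (\<forall>x. (c' has_derivative blinfun_apply (c'' x)) (at x)) \<and>
       continuous_on UNIV c'')"

definition gradient :: "('a::real_inner \<Rightarrow> real) \<Rightarrow> 'a \<Rightarrow> 'a"
  where "gradient \<phi> x = (THE D. GDERIV \<phi> x :> D)"

definition hessian :: "(real^'n \<Rightarrow> real) \<Rightarrow> real^'n \<Rightarrow> real^'n^'n"
  where "hessian \<phi> x = jacobian (gradient \<phi>) (at x)"

definition null_space :: "real^'n^'m \<Rightarrow> (real^'n) set"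
  where "null_space A = {v. A *v v = 0}"

text \<open>The infimum over the empty set is \<open>\<infinity>\<close>, unlike for \<open>infdist\<close>.\<close>

definition edist_set :: "'a::metric_space \<Rightarrow> 'a set \<Rightarrow> ereal"
  where "edist_set w A = (INF a\<in>A. ereal (dist w a))"

text \<open>The convention \<open>0 * \<infinity> = 0\<close> of \<open>ereal\<close> is harmless here, since \<open>\<kappa>\<close> may
  always be enlarged.\<close>

definition strongly_metrically_subregular ::
    "('a::real_normed_vector \<Rightarrow> 'b::metric_space set) \<Rightarrow> 'a \<Rightarrow> 'b \<Rightarrow> bool"
  where "strongly_metrically_subregular S zbar wbar \<longleftrightarrow> wbar \<in> S zbar \<and>
    (\<exists>\<kappa>\<ge>0. \<exists>U. open U \<and> zbar \<in> U \<and>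
       (\<forall>z\<in>U. ereal (norm (z - zbar)) \<le> ereal \<kappa> * edist_set wbar (S z)))"

definition strong_local_minimizer :: "('a::real_normed_vector \<Rightarrow> ereal) \<Rightarrow> 'a \<Rightarrow> bool"
  where "strong_local_minimizer f xbar \<longleftrightarrow>
    (\<exists>U. \<exists>\<gamma>>0. open U \<and> xbar \<in> U \<and>
       (\<forall>x \<in> U \<inter> domain f. f xbar + ereal (\<gamma> * (norm (x - xbar))\<^sup>2) \<le> f x))"

definition basic_cq :: "(real^'m \<Rightarrow> ereal) \<Rightarrow> (real^'n \<Rightarrow> real^'m) \<Rightarrow> real^'n \<Rightarrow> bool"
  where "basic_cq h c x \<longleftrightarrow>
    null_space (transpose (jacobian c (at x))) \<inter> normal_cone (c x) (domain h) = {0}"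

definition multipliers :: "(real^'m \<Rightarrow> ereal) \<Rightarrow> (real^'n \<Rightarrow> real^'m) \<Rightarrow> real^'n \<Rightarrow> (real^'m) set"
  where "multipliers h c x =
    null_space (transpose (jacobian c (at x))) \<inter> subdifferential h (c x)"

definition nonascent_dirs :: "(real^'m \<Rightarrow> ereal) \<Rightarrow> (real^'n \<Rightarrow> real^'m) \<Rightarrow> real^'n \<Rightarrow> (real^'n) set"
  where "nonascent_dirs h c x = {d. dir_deriv h (c x) (jacobian c (at x) *v d) \<le> 0}"

text \<open>Under the basic constraint qualification the multiplier set is compact, and it
  is nonempty by the first-order condition, so the supremum is a maximum.\<close>

definition second_order_sufficient ::
    "(real^'m \<Rightarrow> ereal) \<Rightarrow> (real^'n \<Rightarrow> real^'m) \<Rightarrow> real^'n \<Rightarrow> bool"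
  where "second_order_sufficient h c x \<longleftrightarrow>
    0 \<in> (\<lambda>y. transpose (jacobian c (at x)) *v y) ` subdifferential h (c x) \<and>
    (\<forall>d \<in> nonascent_dirs h c x - {0}.
       dir_deriv2 h (c x) (jacobian c (at x) *v d) +
       (SUP y \<in> multipliers h c x. ereal (d \<bullet> (hessian (\<lambda>u. y \<bullet> c u) x *v d))) > 0)"

definition kkt_g :: "(real^'n \<Rightarrow> real^'m) \<Rightarrow> (real^'n) \<times> (real^'m) \<Rightarrow> (real^'n) \<times> (real^'m)"
  where "kkt_g c = (\<lambda>(x, y). (transpose (jacobian c (at x)) *v y, - c x))"

definition kkt_G :: "(real^'m \<Rightarrow> ereal) \<Rightarrow> (real^'n) \<times> (real^'m) \<Rightarrow> ((real^'n) \<times> (real^'m)) set"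
  where "kkt_G h = (\<lambda>(x, y). {0} \<times> subdifferential (conjugate h) y)"

end

theory Submission
  imports Defs
begin

text \<open>
  Write \<open>H\<close> for the finite values of \<open>h\<close> and \<open>w = \<nabla>c(xbar) d\<close>. If subregularity or quadratic
  growth fails, a normalised sequence of violating points lies, after passing to a subsequence, in
  one piece of \<open>h\<close>; there the subgradient inequalities produce in the limit either a second
  multiplier or a critical direction \<open>d \<noteq> 0\<close> with \<open>h''(c(xbar); w) + \<langle>d, \<nabla>\<^sup>2(ybar c)(xbar) d\<rangle> \<le> 0\<close>.

  For the converse no duality is needed. Consider the augmented Lagrangian
  \<open>H v + \<langle>ybar, c x - v\<rangle> + r/2 |c x - v|\<^sup>2\<close> minus a small multiple of \<open>|x - xbar|\<^sup>2\<close>, minimised over a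
  small box. For large \<open>r\<close> its minimisers satisfy the KKT system up to a residual dominated by
  subregularity, so that they coincide with \<open>(xbar, c xbar)\<close>. Comparing with the points
  \<open>(xbar + t d, c xbar + t w)\<close>, which are feasible for critical \<open>d\<close>, gives the second-order condition.
\<close>

text \<open>Two obstacles shape the argument. In a sequence violating subregularity the pair (x, y)
  is normalised jointly, so the x-part of the limit direction may vanish while its y-part \<eta>
  does not. A multiplier \<open>ybar + t \<eta>\<close> must then be an exact subgradient at
  c(xbar), although the given subgradients belong to other points. This works because those points
  approach c(xbar) faster than the normalising scale and the subdifferential there is cut out by
  finitely many linear inequalities.

  In the converse, growth of f cannot simply be tested at xbar + t d: c(xbar + t d) differs from
  c(xbar) + t w by O(t^2), which may leave dom h even if w is a feasible direction. The extra
  variable v stays in dom h, and the defect c(x) - v = O(t^2) enters the penalty only at order t^4,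
  while the multiplier term yields half of t^2 times the curvature of ybar c. The price is that r
  must be fixed before t tends to 0. Subregularity pays it: for one finite r the minimiser equals
  (xbar, c(xbar)) instead of being merely close to it.\<close>

section \<open>First- and second-order expansions along sequences\<close>

lemma has_derivative_seq_quotient:
  fixes g :: "'a::real_normed_vector \<Rightarrow> 'b::real_normed_vector"
  assumes g: "(g has_derivative g') (at x)" and X: "X \<longlonglongrightarrow> x"
    and T: "\<And>n. T n > 0" and D: "(\<lambda>n. (1 / T n) *\<^sub>R (X n - x)) \<longlonglongrightarrow> d"
  shows "(\<lambda>n. (1 / T n) *\<^sub>R (g (X n) - g x)) \<longlonglongrightarrow> g' d"
proof -
  \<comment> \<open>The value 0 at \<open>x\<close> makes \<open>E\<close> continuous there, so
    terms with \<open>X n = x\<close> are covered.\<close>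
  define E where "E y = (if y = x then 0 else (1 / norm (y - x)) *\<^sub>R (g y - (g x + g' (y - x))))" for y
  have bl: "bounded_linear g'" using g by (rule has_derivative_bounded_linear)
  have "((\<lambda>y. (1 / norm (y - x)) *\<^sub>R (g y - (g x + g' (y - x)))) \<longlongrightarrow> 0) (at x)"
    using g unfolding has_derivative_within by simp
  then have "(E \<longlongrightarrow> 0) (at x)"
    by (rule Lim_transform_eventually) (auto simp: E_def eventually_at_filter)
  then have "(E \<longlongrightarrow> E x) (at x)" by (simp add: E_def)
  then have "isCont E x" by (simp add: isCont_def)
  then have E: "(\<lambda>n. E (X n)) \<longlonglongrightarrow> 0"
    using X isCont_tendsto_compose[of x E X] by (simp add: E_def)
  have "(\<lambda>n. norm ((1 / T n) *\<^sub>R (X n - x)) *\<^sub>R E (X n) + g' ((1 / T n) *\<^sub>R (X n - x)))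
      \<longlonglongrightarrow> norm d *\<^sub>R 0 + g' d"
    by (intro tendsto_intros D E bounded_linear.tendsto[OF bl])
  moreover have "norm ((1 / T n) *\<^sub>R (X n - x)) *\<^sub>R E (X n) + g' ((1 / T n) *\<^sub>R (X n - x))
      = (1 / T n) *\<^sub>R (g (X n) - g x)" for n
  proof (cases "X n = x")
    case True
    then show ?thesis using bounded_linear.linear[OF bl] by (simp add: linear_0)
  next
    case False
    then have "norm ((1 / T n) *\<^sub>R (X n - x)) *\<^sub>R E (X n)
        = (1 / T n) *\<^sub>R (g (X n) - (g x + g' (X n - x)))"
      using T[of n] unfolding E_def if_not_P[OF False] norm_scaleR by simp
    then show ?thesis
      by (simp only: linear_scale[OF bounded_linear.linear[OF bl]]) (simp add: algebra_simps)
  qed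
  ultimately show ?thesis by simp
qed

text \<open>Mean value inequality for the Taylor remainder on the segment from \<open>x\<close> to
  \<open>y\<close>: its derivative is the first-order error of \<open>c'\<close> at
  \<open>x\<close>, applied to \<open>y - x\<close>, hence of size e |y - x|^2.\<close>

lemma second_order_taylor_bound:
  fixes c :: "'a::real_normed_vector \<Rightarrow> 'b::real_normed_vector" and c' :: "'a \<Rightarrow> 'a \<Rightarrow>\<^sub>L 'b"
  assumes c: "\<And>x. (c has_derivative blinfun_apply (c' x)) (at x)"
    and c': "(c' has_derivative blinfun_apply c'') (at x)" and "e > 0"
  shows "\<exists>\<delta>>0. \<forall>y. norm (y - x) < \<delta> \<longrightarrow>
    norm (c y - c x - c' x (y - x) - (1/2) *\<^sub>R c'' (y - x) (y - x)) \<le> e * (norm (y - x))\<^sup>2"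
proof -
  obtain \<delta> where \<delta>: "\<delta> > 0"
    "\<And>y. norm (y - x) < \<delta> \<Longrightarrow> norm (c' y - c' x - c'' (y - x)) \<le> e * norm (y - x)"
    using c' \<open>e > 0\<close> unfolding has_derivative_at_alt by blast
  have "norm (c y - c x - c' x (y - x) - (1/2) *\<^sub>R c'' (y - x) (y - x)) \<le> e * (norm (y - x))\<^sup>2"
    if y: "norm (y - x) < \<delta>" for y
  proof -
    define u where "u = y - x"
    define R where "R t = c (x + t *\<^sub>R u) - c x - t *\<^sub>R c' x u - (t\<^sup>2/2) *\<^sub>R c'' u u" for t :: real
    define R' where "R' t = c' (x + t *\<^sub>R u) u - c' x u - t *\<^sub>R c'' u u" for t :: real
    have cd: "((\<lambda>t. c (x + t *\<^sub>R u)) has_derivative (\<lambda>s. c' (x + t *\<^sub>R u) (s *\<^sub>R u))) (at t within {0..1})" for t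
      by (rule has_derivative_compose[of "\<lambda>t. x + t *\<^sub>R u" _ _ _ c, OF _ c, of "\<lambda>s. s *\<^sub>R u"])
        (auto intro!: derivative_eq_intros)
    have der: "(R has_derivative (\<lambda>s. s *\<^sub>R R' t)) (at t within {0..1})" for t
      unfolding R_def
      by (rule derivative_eq_intros cd refl | simp)+
        (auto simp: R'_def fun_eq_iff blinfun.scaleR_right algebra_simps)
    have bd: "norm (R' t) \<le> e * (norm u)\<^sup>2" if t: "t \<in> {0..1}" for t
    proof -
      have "norm (t *\<^sub>R u) \<le> norm u" using t by (simp add: mult_left_le_one_le)
      then have "norm (c' (x + t *\<^sub>R u) - c' x - c'' (t *\<^sub>R u)) \<le> e * norm (t *\<^sub>R u)"
        using \<delta>(2)[of "x + t *\<^sub>R u"] y unfolding u_def by simp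
      also have "\<dots> \<le> e * norm u" using \<open>norm (t *\<^sub>R u) \<le> norm u\<close> \<open>e > 0\<close> by simp
      finally have 1: "norm (c' (x + t *\<^sub>R u) - c' x - c'' (t *\<^sub>R u)) \<le> e * norm u" .
      have "R' t = (c' (x + t *\<^sub>R u) - c' x - c'' (t *\<^sub>R u)) u"
        by (simp add: R'_def blinfun.diff_left blinfun.scaleR_right blinfun.scaleR_left)
      then have "norm (R' t) \<le> norm (c' (x + t *\<^sub>R u) - c' x - c'' (t *\<^sub>R u)) * norm u"
        using norm_blinfun by metis
      also have "\<dots> \<le> e * norm u * norm u" using 1 by (intro mult_right_mono) auto
      finally show ?thesis by (simp add: power2_eq_square mult.assoc)
    qed
    have "onorm (\<lambda>s. s *\<^sub>R R' t) \<le> e * (norm u)\<^sup>2" if "t \<in> {0..1}" for t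
      using bd[OF that] \<open>e > 0\<close>
      by (intro onorm_bound) (auto simp: mult.commute intro!: mult_left_mono)
    then have "norm (R 1 - R 0) \<le> e * (norm u)\<^sup>2 * norm (1 - 0 :: real)"
      by (intro differentiable_bound[OF _ der]) auto
    then show ?thesis by (simp add: R_def u_def)
  qed
  then show ?thesis using \<delta>(1) by blast
qed

lemma second_order_seq_quotient:
  fixes c :: "'a::real_normed_vector \<Rightarrow> 'b::real_normed_vector" and c' :: "'a \<Rightarrow> 'a \<Rightarrow>\<^sub>L 'b"
  assumes c: "\<And>x. (c has_derivative blinfun_apply (c' x)) (at x)"
    and c': "(c' has_derivative blinfun_apply c'') (at x)" and X: "X \<longlonglongrightarrow> x"
    and T: "\<And>n. T n > 0" and D: "(\<lambda>n. (1 / T n) *\<^sub>R (X n - x)) \<longlonglongrightarrow> d"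
  shows "(\<lambda>n. (1 / (T n)\<^sup>2) *\<^sub>R (c (X n) - c x - c' x (X n - x))) \<longlonglongrightarrow> (1/2) *\<^sub>R c'' d d"
proof -
  define E where "E y = (if y = x then 0 else
    (1 / (norm (y - x))\<^sup>2) *\<^sub>R (c y - c x - c' x (y - x) - (1/2) *\<^sub>R c'' (y - x) (y - x)))" for y
  have "(\<lambda>n. E (X n)) \<longlonglongrightarrow> 0"
  proof (rule tendstoI)
    fix e :: real assume "e > 0"
    then obtain \<delta> where \<delta>: "\<delta> > 0" "\<And>y. norm (y - x) < \<delta> \<Longrightarrow>
        norm (c y - c x - c' x (y - x) - (1/2) *\<^sub>R c'' (y - x) (y - x)) \<le> (e/2) * (norm (y - x))\<^sup>2"
      using second_order_taylor_bound[OF c c', of "e/2"] by auto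
    have "norm (E y) < e" if y: "norm (y - x) < \<delta>" for y
    proof (cases "y = x")
      case False
      have "norm (E y) = norm (c y - c x - c' x (y - x) - (1/2) *\<^sub>R c'' (y - x) (y - x)) / (norm (y - x))\<^sup>2"
        using False unfolding E_def if_not_P[OF False] norm_scaleR by simp
      also have "\<dots> \<le> e/2"
        using \<delta>(2)[OF y] False by (subst pos_divide_le_eq) auto
      finally have "norm (E y) \<le> e/2" .
      then show ?thesis using \<open>e > 0\<close> by simp
    qed (use \<open>e > 0\<close> in \<open>simp add: E_def\<close>)
    moreover have "\<forall>\<^sub>F n in sequentially. dist (X n) x < \<delta>"
      using X \<delta>(1) by (rule tendstoD)
    ultimately show "\<forall>\<^sub>F n in sequentially. dist (E (X n)) 0 < e"
      by (auto elim!: eventually_mono simp: dist_norm)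
  qed
  then have "(\<lambda>n. (norm ((1 / T n) *\<^sub>R (X n - x)))\<^sup>2 *\<^sub>R E (X n)
        + (1/2) *\<^sub>R c'' ((1 / T n) *\<^sub>R (X n - x)) ((1 / T n) *\<^sub>R (X n - x)))
      \<longlonglongrightarrow> (norm d)\<^sup>2 *\<^sub>R 0 + (1/2) *\<^sub>R c'' d d"
    by (intro tendsto_intros D)
  moreover have "(norm ((1 / T n) *\<^sub>R (X n - x)))\<^sup>2 *\<^sub>R E (X n)
        + (1/2) *\<^sub>R c'' ((1 / T n) *\<^sub>R (X n - x)) ((1 / T n) *\<^sub>R (X n - x))
      = (1 / (T n)\<^sup>2) *\<^sub>R (c (X n) - c x - c' x (X n - x))" for n
  proof (cases "X n = x")
    case False
    have "(norm ((1 / T n) *\<^sub>R (X n - x)))\<^sup>2 = (norm (X n - x))\<^sup>2 / (T n)\<^sup>2"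
      by (simp add: power_divide)
    then have "(norm ((1 / T n) *\<^sub>R (X n - x)))\<^sup>2 *\<^sub>R E (X n)
        = (1 / (T n)\<^sup>2) *\<^sub>R (c (X n) - c x - c' x (X n - x) - (1/2) *\<^sub>R c'' (X n - x) (X n - x))"
      using False T[of n] unfolding E_def if_not_P[OF False] by simp
    moreover have "c'' ((1 / T n) *\<^sub>R (X n - x)) ((1 / T n) *\<^sub>R (X n - x))
        = (1 / (T n)\<^sup>2) *\<^sub>R c'' (X n - x) (X n - x)"
      by (simp only: blinfun.scaleR_right blinfun.scaleR_left) (simp add: power2_eq_square)
    ultimately show ?thesis by (simp only:) (simp add: algebra_simps)
  qed (simp add: E_def)
  ultimately show ?thesis by simp
qed

section \<open>Jacobian and Hessian matrices\<close>

lemma jacobian_apply: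
  fixes c :: "real^'n \<Rightarrow> real^'m"
  assumes "(c has_derivative c') (at x)"
  shows "jacobian c (at x) *v e = c' e"
  using has_derivative_unique[OF assms jacobian_works[THEN iffD1]] assms
  by (metis differentiable_def)

lemma transpose_jacobian_inner:
  fixes c :: "real^'n \<Rightarrow> real^'m"
  assumes "(c has_derivative c') (at x)"
  shows "(transpose (jacobian c (at x)) *v y) \<bullet> e = y \<bullet> c' e"
  by (simp add: transpose_matrix_vector dot_lmul_matrix jacobian_apply[OF assms])

text \<open>The proof works with derivatives as bounded linear maps; this translates the Hessian
  matrix into them. The vector multiplied by the matrix is the direction in which \<open>c'\<close>
  is differentiated, hence the order \<open>c'' e d\<close>.\<close>

lemma hessian_inner:
  fixes c :: "real^'n \<Rightarrow> real^'m" and c' :: "real^'n \<Rightarrow> (real^'n) \<Rightarrow>\<^sub>L (real^'m)"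
  assumes c: "\<And>x. (c has_derivative blinfun_apply (c' x)) (at x)"
    and c': "(c' has_derivative blinfun_apply c'') (at x)"
  shows "d \<bullet> (hessian (\<lambda>u. y \<bullet> c u) x *v e) = y \<bullet> c'' e d"
proof -
  define G where "G u = (\<chi> i. y \<bullet> c' u (axis i 1))" for u
  have expand: "(\<chi> i. y \<bullet> L (axis i 1)) \<bullet> v = y \<bullet> L v"
    for L :: "(real^'n) \<Rightarrow>\<^sub>L (real^'m)" and v
  proof -
    have "y \<bullet> L v = y \<bullet> L (\<Sum>i\<in>UNIV. v $ i *\<^sub>R axis i 1)"
      using basis_expansion[of v] by (simp add: scalar_mult_eq_scaleR)
    also have "\<dots> = (\<Sum>i\<in>UNIV. (y \<bullet> L (axis i 1)) * v $ i)"
      by (simp add: blinfun.sum_right blinfun.scaleR_right inner_sum_right mult.commute)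
    finally show ?thesis by (simp add: inner_vec_def)
  qed
  have "GDERIV (\<lambda>u. y \<bullet> c u) u :> G u" for u
    unfolding gderiv_def
    by (rule has_derivative_eq_rhs[OF has_derivative_inner_right[OF c]])
      (simp add: G_def expand inner_commute[of _ "vec_lambda _"])
  then have "gradient (\<lambda>u. y \<bullet> c u) u = G u" for u
    unfolding gradient_def gderiv_def
    by (intro the_equality) (auto dest!: has_derivative_unique simp: fun_eq_iff vector_eq_ldot)
  then have "gradient (\<lambda>u. y \<bullet> c u) = G" by (rule ext)
  moreover have "(G has_derivative (\<lambda>v. \<chi> i. y \<bullet> c'' v (axis i 1))) (at x)"
    unfolding G_def
  proof (subst has_derivative_componentwise_within, intro ballI)
    fix b :: "real^'n" assume "b \<in> Basis"
    then obtain i where b: "b = axis i 1" by (auto simp: Basis_vec_def)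
    have "((\<lambda>u. y \<bullet> c' u (axis i 1)) has_derivative (\<lambda>v. y \<bullet> c'' v (axis i 1))) (at x)"
      by (intro has_derivative_inner_right bounded_linear.has_derivative[OF _ c']
          blinfun.bounded_linear_left)
    then show "((\<lambda>u. (\<chi> i. y \<bullet> c' u (axis i 1)) \<bullet> b) has_derivative
        (\<lambda>v. (\<chi> i. y \<bullet> c'' v (axis i 1)) \<bullet> b)) (at x)"
      by (simp add: b inner_axis)
  qed
  ultimately have "hessian (\<lambda>u. y \<bullet> c u) x *v e = (\<chi> i. y \<bullet> c'' e (axis i 1))"
    unfolding hessian_def by (metis jacobian_apply)
  then show ?thesis using expand by (simp add: inner_commute)
qed

section \<open>Epigraphs and subgradients of the conjugate\<close>

lemma convex_epigraph:
  assumes "econvex h"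
  shows "convex {p. h (fst p) \<le> ereal (snd p)}"
proof (rule convexI)
  fix p q :: "'a \<times> real" and s t :: real
  assume p: "p \<in> {p. h (fst p) \<le> ereal (snd p)}" and q: "q \<in> {p. h (fst p) \<le> ereal (snd p)}"
    and st: "0 \<le> s" "0 \<le> t" "s + t = 1"
  show "s *\<^sub>R p + t *\<^sub>R q \<in> {p. h (fst p) \<le> ereal (snd p)}"
  proof (cases "t = 0 \<or> t = 1")
    case True
    then show ?thesis using st p q by auto
  next
    case False
    then have "0 < t \<and> t < 1" and s: "s = 1 - t" using st by auto
    then have "h (s *\<^sub>R fst p + t *\<^sub>R fst q) \<le> ereal s * h (fst p) + ereal t * h (fst q)"
      using assms unfolding econvex_def by auto
    also have "\<dots> \<le> ereal s * ereal (snd p) + ereal t * ereal (snd q)"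
      using p q st by (intro add_mono ereal_mult_left_mono) auto
    finally show ?thesis by simp
  qed
qed

text \<open>The supremum defining the conjugate at \<open>y\<close> is attained at \<open>v\<close>,
  and at any other \<open>z\<close> the same \<open>v\<close> is a competitor.\<close>

lemma subdifferential_conjugateI:
  assumes h: "proper h" and y: "y \<in> subdifferential h v"
  shows "v \<in> subdifferential (conjugate h) y"
proof -
  obtain a where a: "h v = ereal a" using y unfolding subdifferential_def by auto
  have "conjugate h y = ereal (y \<bullet> v - a)"
    unfolding conjugate_def
  proof (rule antisym)
    show "(SUP c. ereal (y \<bullet> c) - h c) \<le> ereal (y \<bullet> v - a)"
    proof (rule SUP_least)
      fix c
      have "ereal a + ereal (y \<bullet> (c - v)) \<le> h c"
        using y a unfolding subdifferential_def by auto
      then show "ereal (y \<bullet> c) - h c \<le> ereal (y \<bullet> v - a)"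
        by (cases "h c") (auto simp: inner_diff_right)
    qed
    show "ereal (y \<bullet> v - a) \<le> (SUP c. ereal (y \<bullet> c) - h c)"
      by (rule SUP_upper2[of v]) (auto simp: a)
  qed
  moreover have "ereal (z \<bullet> v - a) \<le> conjugate h z" for z
    unfolding conjugate_def by (rule SUP_upper2[of v]) (auto simp: a)
  ultimately show ?thesis
    unfolding subdifferential_def by (auto simp: inner_diff_right inner_commute)
qed

text \<open>The crucial claim is \<open>h v \<le> a\<close>, equality in the Fenchel-Young
  inequality. If it fails, (v, a) is separated from the closed convex epigraph, and the hyperplane
  exhibits a point where the conjugate is too small for \<open>v\<close> to be a
  subgradient.\<close>

lemma subdifferential_conjugateD:
  fixes h :: "'a::euclidean_space \<Rightarrow> ereal"
  assumes h: "proper h" "econvex h" and cl: "closed {p. h (fst p) \<le> ereal (snd p)}"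
    and v: "v \<in> subdifferential (conjugate h) y"
  shows "y \<in> subdifferential h v"
proof -
  have nm: "h c \<noteq> -\<infinity>" for c using h(1) unfolding proper_def by auto
  obtain s where s: "conjugate h y = ereal s" using v unfolding subdifferential_def by auto
  have sub: "ereal (s + v \<bullet> (z - y)) \<le> conjugate h z" for z
    using v s unfolding subdifferential_def by auto
  have young: "ereal (y \<bullet> z - s) \<le> h z" for z
  proof -
    have "ereal (y \<bullet> z) - h z \<le> ereal s"
      unfolding s[symmetric] conjugate_def by (rule SUP_upper) auto
    then show ?thesis using nm[of z] by (cases "h z") auto
  qed
  define a where "a = v \<bullet> y - s"
  have "h v \<le> ereal a"
  proof (rule ccontr)
    assume "\<not> h v \<le> ereal a"
    then have notin: "(v, a) \<notin> {p. h (fst p) \<le> ereal (snd p)}" by simp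
    obtain p \<beta> where p: "p \<bullet> (v, a) < \<beta>"
      "\<And>x. x \<in> {p. h (fst p) \<le> ereal (snd p)} \<Longrightarrow> p \<bullet> x > \<beta>"
      using separating_hyperplane_closed_point[OF convex_epigraph[OF h(2)] cl notin] by blast
    obtain q r where [simp]: "p = (q, r)" by (cases p)
    have epi: "q \<bullet> u + r * b > \<beta>" if "h u \<le> ereal b" for u b
      using p(2)[of "(u, b)"] that by simp
    have pt: "q \<bullet> v + r * a < \<beta>" using p(1) by simp
    obtain u0 where "h u0 < \<infinity>" using h(1) unfolding proper_def domain_def by auto
    then obtain b0 where b0: "h u0 = ereal b0" using nm[of u0] by (cases "h u0") auto
    have "r \<ge> 0"
    proof (rule ccontr)
      assume "\<not> r \<ge> 0"
      \<comment> \<open>At this height a hyperplane with negative \<open>r\<close> has been crossed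
        by the vertical ray of the epigraph above \<open>u0\<close>.\<close>
      define M where "M = max b0 ((q \<bullet> u0 - \<beta>) / (-r))"
      have "q \<bullet> u0 + r * M > \<beta>" using epi[of u0 M] b0 by (simp add: M_def)
      moreover have "r * M \<le> r * ((q \<bullet> u0 - \<beta>) / (-r))"
        using \<open>\<not> r \<ge> 0\<close> by (intro mult_left_mono_neg) (auto simp: M_def)
      ultimately show False using \<open>\<not> r \<ge> 0\<close> by simp
    qed
    show False
    proof (cases "r = 0")
      case True
      \<comment> \<open>A vertical hyperplane is not the graph of an affine minorant; added to the
        minorant of slope \<open>y\<close> it gives one of slope \<open>y - q\<close>.\<close>
      have "conjugate h (y - q) \<le> ereal (s - \<beta>)"
        unfolding conjugate_def
      proof (rule SUP_least)
        fix u
        show "ereal ((y - q) \<bullet> u) - h u \<le> ereal (s - \<beta>)"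
          using young[of u] epi[of u "real_of_ereal (h u)"] nm[of u] True
          by (cases "h u") (auto simp: inner_diff_left)
      qed
      with sub[of "y - q"] have "ereal (s + v \<bullet> (y - q - y)) \<le> ereal (s - \<beta>)"
        by (rule order_trans)
      then show False using pt True by (simp add: inner_commute)
    next
      case False
      then have r: "r > 0" using \<open>r \<ge> 0\<close> by simp
      \<comment> \<open>Normalising by \<open>r\<close> turns the hyperplane into the graph of an
        affine minorant of \<open>h\<close> with slope \<open>q'\<close>.\<close>
      define q' where "q' = (- 1 / r) *\<^sub>R q"
      have "conjugate h q' \<le> ereal (- \<beta> / r)"
        unfolding conjugate_def
      proof (rule SUP_least)
        fix u
        show "ereal (q' \<bullet> u) - h u \<le> ereal (- \<beta> / r)"
        proof (cases "h u")
          case (real d)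
          then have "(- 1 / r) * (q \<bullet> u + r * d) \<le> (- 1 / r) * \<beta>"
            using epi[of u d] r by (intro mult_left_mono_neg) auto
          then show ?thesis using real r by (simp add: q'_def algebra_simps)
        qed (use nm in auto)
      qed
      with sub[of q'] have "ereal (s + v \<bullet> (q' - y)) \<le> ereal (- \<beta> / r)"
        by (rule order_trans)
      then show False
      proof -
        have "(- 1 / r) * \<beta> < (- 1 / r) * (q \<bullet> v + r * a)"
          using pt r by (intro mult_strict_left_mono_neg) auto
        moreover have "(- 1 / r) * (q \<bullet> v + r * a) = q' \<bullet> v - a"
          using r by (simp add: q'_def field_simps)
        ultimately show False
          using \<open>ereal (s + v \<bullet> (q' - y)) \<le> ereal (- \<beta> / r)\<close>
          by (simp add: a_def inner_commute inner_diff_right)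
      qed
    qed
  qed
  then obtain b where b: "h v = ereal b" "b \<le> a" using nm[of v] by (cases "h v") auto
  have "h v + ereal (y \<bullet> (z - v)) \<le> h z" for z
  proof -
    have "h v + ereal (y \<bullet> (z - v)) \<le> ereal (y \<bullet> z - s)"
      using b by (simp add: a_def inner_diff_right inner_commute)
    also have "\<dots> \<le> h z" by (rule young)
    finally show ?thesis .
  qed
  then show ?thesis using b unfolding subdifferential_def by auto
qed

text \<open>Divide by \<open>t\<close> and let it tend to 0. This is how inequalities tested on
  short segments yield first-order conditions below.\<close>

lemma nonneg_of_linear_plus_quadratic:
  fixes a b s :: real
  assumes "s > 0" and "\<And>t. 0 < t \<Longrightarrow> t < s \<Longrightarrow> 0 \<le> t * a + t\<^sup>2 * b"
  shows "0 \<le> a"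
proof (rule tendsto_lowerbound)
  show "((\<lambda>t. a + t * b) \<longlongrightarrow> a) (at_right 0)"
    by (auto intro!: tendsto_eq_intros)
  show "\<forall>\<^sub>F t in at_right 0. 0 \<le> a + t * b"
    using eventually_at_right_less[of 0] order_tendstoD(2)[OF tendsto_ident_at assms(1), of "{0<..}"]
  proof eventually_elim
    case (elim t)
    then have "0 \<le> t * (a + t * b)"
      using assms(2)[of t] by (simp add: algebra_simps power2_eq_square)
    then show ?case using elim by (simp add: zero_le_mult_iff)
  qed
qed simp

section \<open>Convex piecewise linear-quadratic functions\<close>

locale convex_plq =
  fixes h :: "real^'m \<Rightarrow> ereal" and K :: nat and C :: "nat \<Rightarrow> (real^'m) set"
    and Q :: "nat \<Rightarrow> real^'m^'m" and b :: "nat \<Rightarrow> real^'m" and \<beta> :: "nat \<Rightarrow> real"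
  assumes proper: "proper h" and econvex: "econvex h"
    and domain_eq: "domain h = (\<Union>k<K. C k)"
    and polyhedron_piece: "\<And>k. k < K \<Longrightarrow> polyhedron (C k)"
    and transpose_piece: "\<And>k. k < K \<Longrightarrow> transpose (Q k) = Q k"
    and piece: "\<And>k v. k < K \<Longrightarrow> v \<in> C k \<Longrightarrow>
      h v = ereal (1/2 * (v \<bullet> (Q k *v v)) + b k \<bullet> v + \<beta> k)"
begin

text \<open>Outside the domain \<open>real_of_ereal\<close> returns the default 0, so
  \<open>H\<close> is only used together with membership in \<open>domain h\<close>.\<close>

definition H :: "real^'m \<Rightarrow> real" where "H v = real_of_ereal (h v)"

text \<open>At a point shared by several pieces these gradients may differ.\<close>

definition piece_gradient :: "nat \<Rightarrow> real^'m \<Rightarrow> real^'m"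
  where "piece_gradient k v = Q k *v v + b k"

lemma not_minus_infinity: "h v \<noteq> -\<infinity>"
  using proper unfolding proper_def by auto

lemma h_eq: "v \<in> domain h \<Longrightarrow> h v = ereal (H v)"
  using not_minus_infinity[of v] unfolding domain_def H_def by (cases "h v") auto

lemma h_outside: "v \<notin> domain h \<Longrightarrow> h v = \<infinity>"
  unfolding domain_def by auto

lemma piece_subset_domain: "k < K \<Longrightarrow> v \<in> C k \<Longrightarrow> v \<in> domain h"
  unfolding domain_eq by auto

lemma closed_domain: "closed (domain h)"
  unfolding domain_eq by (intro closed_UN) (auto intro: polyhedron_imp_closed polyhedron_piece)

lemma continuous_on_H: "continuous_on (domain h) H"
  unfolding domain_eq
proof (rule continuous_on_closed_Union)
  fix k assume k: "k \<in> {..<K}"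
  have "continuous_on (C k) (\<lambda>v. 1/2 * (v \<bullet> (Q k *v v)) + b k \<bullet> v + \<beta> k)"
    by (intro continuous_intros matrix_vector_mult_linear_continuous_on)
  then show "continuous_on (C k) H"
    by (rule continuous_on_eq) (use k in \<open>auto simp: H_def piece\<close>)
qed (auto intro: polyhedron_imp_closed polyhedron_piece)

lemma H_convex:
  assumes "v \<in> domain h" "z \<in> domain h" "0 \<le> t" "t \<le> 1"
  shows "v + t *\<^sub>R (z - v) \<in> domain h \<and> H (v + t *\<^sub>R (z - v)) \<le> H v + t * (H z - H v)"
proof -
  have "(1 - t) *\<^sub>R (v, H v) + t *\<^sub>R (z, H z) \<in> {p. h (fst p) \<le> ereal (snd p)}"
    using assms h_eq by (intro convexD[OF convex_epigraph[OF econvex]]) auto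
  then have le: "h (v + t *\<^sub>R (z - v)) \<le> ereal (H v + t * (H z - H v))"
    by (simp add: algebra_simps)
  then have "v + t *\<^sub>R (z - v) \<in> domain h" unfolding domain_def by (auto intro: order_le_less_trans)
  then show ?thesis using le h_eq by simp
qed

text \<open>The domain is closed and \<open>H\<close> is continuous on it; this is the lower
  semicontinuity that the inversion of the conjugate's subdifferential asks for.\<close>

lemma closed_epigraph: "closed {p. h (fst p) \<le> ereal (snd p)}"
proof -
  have "closed (domain h \<times> (UNIV::real set) \<inter> (\<lambda>p. H (fst p) - snd p) -` {..0})"
    by (intro continuous_closed_preimage closed_Times closed_domain closed_UNIV closed_atMost
        continuous_intros continuous_on_compose2[OF continuous_on_H]) auto
  also have "domain h \<times> (UNIV::real set) \<inter> (\<lambda>p. H (fst p) - snd p) -` {..0}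
      = {p. h (fst p) \<le> ereal (snd p)}"
  proof (intro set_eqI)
    fix p :: "(real^'m) \<times> real"
    show "p \<in> domain h \<times> UNIV \<inter> (\<lambda>p. H (fst p) - snd p) -` {..0}
        \<longleftrightarrow> p \<in> {p. h (fst p) \<le> ereal (snd p)}"
      using h_eq[of "fst p"] h_outside[of "fst p"]
      by (cases "fst p \<in> domain h") (auto simp: mem_Times_iff)
  qed
  finally show ?thesis .
qed

lemma subdifferential_conjugate: "v \<in> subdifferential (conjugate h) y \<longleftrightarrow> y \<in> subdifferential h v"
  using subdifferential_conjugateI[OF proper] subdifferential_conjugateD[OF proper econvex closed_epigraph]
  by blast

lemma subdifferential_iff:
  "y \<in> subdifferential h v \<longleftrightarrow> v \<in> domain h \<and> (\<forall>z\<in>domain h. H v + y \<bullet> (z - v) \<le> H z)"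
proof (cases "v \<in> domain h")
  case True
  have "(h v + ereal (y \<bullet> (z - v)) \<le> h z) \<longleftrightarrow> (z \<in> domain h \<longrightarrow> H v + y \<bullet> (z - v) \<le> H z)" for z
    using h_eq[OF True] h_eq[of z] h_outside[of z] by (cases "z \<in> domain h") auto
  then show ?thesis using True h_eq[OF True] unfolding subdifferential_def by auto
next
  case False
  then show ?thesis using h_outside unfolding subdifferential_def by auto
qed

text \<open>Exact, since \<open>H\<close> is quadratic on the piece; symmetry of \<open>Q k\<close>
  merges the cross terms into the gradient.\<close>

lemma H_expand:
  assumes "k < K" "v \<in> C k" "z \<in> C k"
  shows "H z = H v + piece_gradient k v \<bullet> (z - v) + 1/2 * ((z - v) \<bullet> (Q k *v (z - v)))"
proof -
  have "v \<bullet> (Q k *v z) = z \<bullet> (Q k *v v)"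
    by (metis transpose_piece[OF assms(1)] dot_lmul_matrix transpose_matrix_vector inner_commute)
  then show ?thesis
    using assms
    by (simp add: H_def piece piece_gradient_def matrix_vector_mult_diff_distrib inner_commute
        algebra_simps)
qed

lemma piece_segment:
  assumes "k < K" "v \<in> C k" "z \<in> C k" "0 \<le> t" "t \<le> 1"
  shows "v + t *\<^sub>R (z - v) \<in> C k"
proof -
  have "(1 - t) *\<^sub>R v + t *\<^sub>R z \<in> C k"
    using assms by (intro convexD[OF polyhedron_imp_convex[OF polyhedron_piece]]) auto
  then show ?thesis by (simp add: algebra_simps)
qed

lemma H_ray:
  assumes "k < K" "v \<in> C k" "v + s *\<^sub>R w \<in> C k" "0 < s" "0 \<le> t" "t \<le> s"
  shows "v + t *\<^sub>R w \<in> C k"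
    and "H (v + t *\<^sub>R w) = H v + t * (piece_gradient k v \<bullet> w) + t\<^sup>2/2 * (w \<bullet> (Q k *v w))"
proof -
  show mem: "v + t *\<^sub>R w \<in> C k"
    using piece_segment[OF assms(1-3), of "t / s"] assms(4-) by simp
  show "H (v + t *\<^sub>R w) = H v + t * (piece_gradient k v \<bullet> w) + t\<^sup>2/2 * (w \<bullet> (Q k *v w))"
    using H_expand[OF assms(1,2) mem]
    by (simp add: matrix_vector_mult_scaleR power2_eq_square)
qed

text \<open>On the segment from \<open>v\<close> to \<open>z\<close>, \<open>H\<close> is a
  quadratic polynomial whose initial slope no subgradient can exceed.\<close>

lemma subgradient_le_piece_gradient:
  assumes y: "y \<in> subdifferential h v" and k: "k < K" "v \<in> C k" "z \<in> C k"
  shows "y \<bullet> (z - v) \<le> piece_gradient k v \<bullet> (z - v)"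
proof -
  have "0 \<le> piece_gradient k v \<bullet> (z - v) - y \<bullet> (z - v)"
  proof (rule nonneg_of_linear_plus_quadratic[of 1])
    fix t :: real assume t: "0 < t" "t < 1"
    have "v + t *\<^sub>R (z - v) \<in> domain h"
      using H_ray(1)[of k v 1 "z - v" t] k t piece_subset_domain by auto
    then have "H v + y \<bullet> (t *\<^sub>R (z - v)) \<le> H (v + t *\<^sub>R (z - v))"
      using y unfolding subdifferential_iff by (metis add_diff_cancel_left')
    then show "0 \<le> t * (piece_gradient k v \<bullet> (z - v) - y \<bullet> (z - v))
        + t\<^sup>2 * ((z - v) \<bullet> (Q k *v (z - v)) / 2)"
      using H_ray(2)[of k v 1 "z - v" t] k t by (simp add: right_diff_distrib)
  qed simp
  then show ?thesis by simp
qed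

text \<open>Infinitely many terms fall into one of the finitely many pieces, and closedness keeps
  the limit in it. Every limit argument can thus work with a single quadratic.\<close>

lemma sequence_in_piece:
  assumes X: "\<And>n. X n \<in> domain h" and lim: "X \<longlonglongrightarrow> v"
  obtains k r where "k < K" "v \<in> C k" "strict_mono (r :: nat \<Rightarrow> nat)" "\<And>n. X (r n) \<in> C k"
proof -
  have "\<forall>n\<in>UNIV. \<exists>k\<in>{..<K}. X n \<in> C k" using X unfolding domain_eq by auto
  from pigeonhole_infinite_rel[OF infinite_UNIV_nat _ this]
  obtain k where k: "k < K" "infinite {n. X n \<in> C k}" by auto
  then obtain r :: "nat \<Rightarrow> nat" where r: "strict_mono r" "\<forall>n. r n \<in> {n. X n \<in> C k}"
    using infinite_enumerate by blast
  have "(\<lambda>n. X (r n)) \<longlonglongrightarrow> v"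
    using LIMSEQ_subseq_LIMSEQ[OF lim r(1)] by (simp add: o_def)
  then have "v \<in> C k"
    by (rule closed_sequentially[OF polyhedron_imp_closed[OF polyhedron_piece[OF k(1)]], rotated])
      (use r(2) in auto)
  then show ?thesis using that k(1) r by auto
qed

text \<open>Select a piece for points of the ray converging to \<open>v\<close>; by convexity it
  contains the whole segment up to \<open>t\<close>.\<close>

lemma ray_in_piece:
  assumes v: "v \<in> domain h" and w: "v + s *\<^sub>R w \<in> domain h" and s: "s > 0"
  obtains k t where "k < K" "t > 0" "t \<le> s" "v \<in> C k" "v + t *\<^sub>R w \<in> C k"
proof -
  define X where "X n = v + (s * inverse (real (Suc n))) *\<^sub>R w" for n
  have mem: "X n \<in> domain h" for n
    using H_convex[OF v w, of "inverse (real (Suc n))"] by (simp add: X_def mult.commute inverse_le_1_iff)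
  have "X \<longlonglongrightarrow> v + (s * 0) *\<^sub>R w"
    unfolding X_def by (intro tendsto_intros LIMSEQ_inverse_real_of_nat)
  then have lim: "X \<longlonglongrightarrow> v" by simp
  obtain k and r :: "nat \<Rightarrow> nat" where k: "k < K" "v \<in> C k" "\<And>n. X (r n) \<in> C k"
    by (rule sequence_in_piece[OF mem lim]) blast
  have "s * inverse (real (Suc (r 0))) \<le> s * 1"
    using s by (intro mult_left_mono) (auto simp: inverse_le_1_iff)
  then show ?thesis
    using that[of k "s * inverse (real (Suc (r 0)))"] k s unfolding X_def by auto
qed

text \<open>Convexity makes the test local: near \<open>v\<close> the segment to \<open>z\<close>
  stays in one piece containing \<open>v\<close>, its slope there is given by the piece gradient,
  and the chord \<open>H z - H v\<close> is at least that slope.\<close>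

lemma subdifferentialI_pieces:
  assumes v: "v \<in> domain h"
    and ineq: "\<And>k z. k < K \<Longrightarrow> v \<in> C k \<Longrightarrow> z \<in> C k \<Longrightarrow> y \<bullet> (z - v) \<le> piece_gradient k v \<bullet> (z - v)"
  shows "y \<in> subdifferential h v"
  unfolding subdifferential_iff
proof (intro conjI ballI v)
  fix z assume z: "z \<in> domain h"
  obtain k s where k: "k < K" "v \<in> C k" "v + s *\<^sub>R (z - v) \<in> C k" and s: "0 < s" "s \<le> 1"
    by (rule ray_in_piece[of v 1 "z - v"]) (use v z in auto)
  have "0 \<le> H z - H v - piece_gradient k v \<bullet> (z - v)"
  proof (rule nonneg_of_linear_plus_quadratic[OF s(1)])
    fix t assume t: "0 < t" "t < s"
    have "H (v + t *\<^sub>R (z - v)) \<le> H v + t * (H z - H v)"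
      using H_convex[OF v z, of t] s t by auto
    then show "0 \<le> t * (H z - H v - piece_gradient k v \<bullet> (z - v))
        + t\<^sup>2 * (- ((z - v) \<bullet> (Q k *v (z - v)) / 2))"
      using H_ray(2)[OF k s(1), of t] t by (simp add: right_diff_distrib)
  qed
  moreover have "y \<bullet> (z - v) \<le> piece_gradient k v \<bullet> (z - v)"
    using ineq[OF k] s by simp
  ultimately show "H v + y \<bullet> (z - v) \<le> H z" by simp
qed

text \<open>On a short ray \<open>h\<close> is a quadratic polynomial in \<open>t\<close>, so the
  second-order quotient is even constant for small \<open>t\<close>.\<close>

lemma directional_derivatives:
  assumes k: "k < K" "v \<in> C k" "v + s *\<^sub>R w \<in> C k" and s: "0 < s"
  shows "dir_deriv h v w = ereal (piece_gradient k v \<bullet> w)"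
    and "dir_deriv2 h v w = ereal (w \<bullet> (Q k *v w))"
proof -
  let ?g = "piece_gradient k v \<bullet> w" and ?q = "w \<bullet> (Q k *v w)"
  have vd: "h v = ereal (H v)" using h_eq piece_subset_domain k by auto
  have ray: "h (v + t *\<^sub>R w) = ereal (H v + t * ?g + t\<^sup>2/2 * ?q)" if "0 < t" "t < s" for t
    using H_ray[OF k s, of t] that h_eq piece_subset_domain[OF k(1)] by simp
  have ev: "\<forall>\<^sub>F t in at_right 0. 0 < t \<and> t < s"
    using eventually_at_right_less[of 0] order_tendstoD(2)[OF tendsto_ident_at s, of "{0<..}"]
    by eventually_elim auto
  have "((\<lambda>t. ereal (?g + t/2 * ?q)) \<longlongrightarrow> ereal ?g) (at_right 0)"
    by (auto intro!: tendsto_eq_intros)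
  then have "((\<lambda>t. (h (v + t *\<^sub>R w) - h v) / ereal t) \<longlongrightarrow> ereal ?g) (at_right 0)"
    by (rule Lim_transform_eventually)
      (use ev in eventually_elim, auto simp: ray vd field_simps power2_eq_square)
  then show 1: "dir_deriv h v w = ereal ?g"
    unfolding dir_deriv_def by (intro tendsto_Lim) auto
  have "((\<lambda>t. ereal ?q) \<longlongrightarrow> ereal ?q) (at_right (0::real))"
    by simp
  then have "((\<lambda>t. (h (v + t *\<^sub>R w) - h v - ereal t * dir_deriv h v w) / ereal (1/2 * t\<^sup>2))
      \<longlongrightarrow> ereal ?q) (at_right 0)"
    by (rule Lim_transform_eventually)
      (use ev in eventually_elim, auto simp: ray vd 1 field_simps power2_eq_square)
  then show "dir_deriv2 h v w = ereal ?q"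
    unfolding dir_deriv2_def using 1 by (simp add: tendsto_Lim)
qed

text \<open>If the ray never met the domain, all difference quotients would be \<infinity>. So every
  nonascent direction has a short ray inside some piece.\<close>

lemma dir_deriv_less_infinity:
  assumes v: "v \<in> domain h" and fin: "dir_deriv h v w < \<infinity>"
  obtains k s where "k < K" "0 < s" "v \<in> C k" "v + s *\<^sub>R w \<in> C k"
proof -
  have "\<exists>s>0. v + s *\<^sub>R w \<in> domain h"
  proof (rule ccontr)
    assume "\<not> ?thesis"
    then have "h (v + t *\<^sub>R w) = \<infinity>" if "t > 0" for t using that h_outside by blast
    then have "\<forall>\<^sub>F t in at_right 0. \<infinity> = (h (v + t *\<^sub>R w) - h v) / ereal t"
      by (intro eventually_mono[OF eventually_at_right_less[of "0::real"]])
        (auto simp: h_eq[OF v] divide_ereal_def)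
    then have "((\<lambda>t. (h (v + t *\<^sub>R w) - h v) / ereal t) \<longlongrightarrow> \<infinity>) (at_right 0)"
      by (rule Lim_transform_eventually[OF tendsto_const])
    then have "dir_deriv h v w = \<infinity>"
      unfolding dir_deriv_def by (intro tendsto_Lim) auto
    then show False using fin by simp
  qed
  then show ?thesis using ray_in_piece[OF v] that by blast
qed

end

section \<open>Polyhedral tangent directions and perturbed subgradients\<close>

text \<open>Constraints inactive at \<open>z\<close> survive a short step, active ones pass to the
  limit, and there are finitely many. A direction known only as a limit of difference quotients thus
  becomes an actual ray in the piece.\<close>

lemma polyhedron_tangent_direction:
  fixes P :: "'a::euclidean_space set"
  assumes P: "polyhedron P" and z: "z \<in> P" and X: "\<And>n. X n \<in> P"
    and T: "\<And>n::nat. T n > 0" and W: "(\<lambda>n. (1 / T n) *\<^sub>R (X n - z)) \<longlonglongrightarrow> w"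
  obtains s where "s > 0" "z + s *\<^sub>R w \<in> P"
proof -
  obtain F where F: "finite F" "P = \<Inter>F" "\<And>S. S \<in> F \<Longrightarrow> \<exists>a b. S = {x. a \<bullet> x \<le> b}"
    using P unfolding polyhedron_def by metis
  have "\<forall>\<^sub>F t in at_right 0. z + t *\<^sub>R w \<in> S" if S: "S \<in> F" for S
  proof -
    obtain a b where Sab: "S = {x. a \<bullet> x \<le> b}" using F(3)[OF S] by auto
    have az: "a \<bullet> z \<le> b" and aX: "a \<bullet> X n \<le> b" for n
      using z X[of n] S Sab unfolding F(2) by auto
    show ?thesis
    proof (cases "a \<bullet> z < b")
      case True
      have "((\<lambda>t. a \<bullet> (z + t *\<^sub>R w)) \<longlongrightarrow> a \<bullet> (z + 0 *\<^sub>R w)) (at_right 0)"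
        by (intro tendsto_intros)
      then have "\<forall>\<^sub>F t in at_right 0. a \<bullet> (z + t *\<^sub>R w) < b"
        using True by (intro order_tendstoD) auto
      then show ?thesis by eventually_elim (simp add: Sab)
    next
      case False
      then have "a \<bullet> z = b" using az by simp
      have "a \<bullet> w \<le> 0"
      proof (rule LIMSEQ_le_const2[OF tendsto_inner[OF tendsto_const W]])
        show "\<exists>N. \<forall>n\<ge>N. a \<bullet> ((1 / T n) *\<^sub>R (X n - z)) \<le> 0"
          using aX T \<open>a \<bullet> z = b\<close>
          by (auto simp: inner_diff_right divide_nonpos_pos)
      qed
      then have "a \<bullet> (z + t *\<^sub>R w) \<le> b" if "t > 0" for t
        using \<open>a \<bullet> z = b\<close> that by (simp add: inner_add_right mult_nonneg_nonpos)
      then show ?thesis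
        by (intro eventually_mono[OF eventually_at_right_less[of "0::real"]]) (simp add: Sab)
    qed
  qed
  then have "\<forall>\<^sub>F t in at_right 0. \<forall>S\<in>F. z + t *\<^sub>R w \<in> S"
    by (intro eventually_ball_finite F) auto
  then have "\<forall>\<^sub>F t in at_right 0. 0 < t \<and> z + t *\<^sub>R w \<in> P"
    using eventually_at_right_less[of "0::real"] by eventually_elim (auto simp: F(2))
  then obtain t where "0 < t \<and> z + t *\<^sub>R w \<in> P"
    using eventually_happens[of _ "at_right (0::real)"] by auto
  then show ?thesis using that by auto
qed

context convex_plq
begin

text \<open>Test \<open>y0\<close> at \<open>V n\<close> and \<open>Y n\<close> at
  \<open>v0 + (\<epsilon> * T n) u\<close>, where u = z - v0. Adding the inequalities cancels the
  first-order terms, and division by (T n)^2 leaves \<epsilon> (\<eta> \<bullet> u) \<le>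
  \<epsilon>^2 q / 2 in the limit because \<open>V n - v0\<close> is o(T n). Then \<epsilon> tends
  to 0.\<close>

lemma active_direction_bound:
  assumes y0: "y0 \<in> subdifferential h v0"
    and T: "\<And>n. T n > 0" "T \<longlonglongrightarrow> 0" and Y: "\<And>n. Y n \<in> subdifferential h (V n)"
    and V0: "(\<lambda>n. (1 / T n) *\<^sub>R (V n - v0)) \<longlonglongrightarrow> 0"
    and Y\<eta>: "(\<lambda>n. (1 / T n) *\<^sub>R (Y n - y0)) \<longlonglongrightarrow> \<eta>"
    and k: "k < K" "v0 \<in> C k" "z \<in> C k"
    and active: "piece_gradient k v0 \<bullet> (z - v0) = y0 \<bullet> (z - v0)"
  shows "\<eta> \<bullet> (z - v0) \<le> 0"
proof -
  define u where "u = z - v0"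
  define q where "q = u \<bullet> (Q k *v u)"
  define Vn where "Vn n = (1 / T n) *\<^sub>R (V n - v0)" for n
  define Yn where "Yn n = (1 / T n) *\<^sub>R (Y n - y0)" for n
  have V: "V n = v0 + T n *\<^sub>R Vn n" and Yeq: "Y n = y0 + T n *\<^sub>R Yn n" for n
    using T(1)[of n] by (auto simp: Vn_def Yn_def)
  have lim: "Vn \<longlonglongrightarrow> 0" "Yn \<longlonglongrightarrow> \<eta>" using V0 Y\<eta> unfolding Vn_def Yn_def by auto
  have v0u: "v0 + 1 *\<^sub>R u \<in> C k" using k by (simp add: u_def)
  have quad: "0 \<le> \<epsilon> * (- (\<eta> \<bullet> u)) + \<epsilon>\<^sup>2 * (q / 2)" if \<epsilon>: "0 < \<epsilon>" for \<epsilon>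
  proof -
    have ineq: "\<epsilon> * (Yn n \<bullet> u) - Yn n \<bullet> Vn n \<le> \<epsilon>\<^sup>2 * (q / 2)" if small: "\<epsilon> * T n \<le> 1" for n
    proof -
      let ?s = "\<epsilon> * T n"
      have s: "0 \<le> ?s" using \<epsilon> T(1)[of n] by simp
      have mem: "v0 + ?s *\<^sub>R u \<in> C k"
        using H_ray(1)[OF k(1,2) v0u _ s] small by simp
      have Hz: "H (v0 + ?s *\<^sub>R u) = H v0 + ?s * (y0 \<bullet> u) + ?s\<^sup>2/2 * q"
        using H_ray(2)[OF k(1,2) v0u _ s] small active by (simp add: q_def u_def)
      have "V n \<in> domain h" using Y subdifferential_iff by blast
      then have 1: "H v0 + y0 \<bullet> (V n - v0) \<le> H (V n)"
        using y0 subdifferential_iff by blast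
      have 2: "H (V n) + Y n \<bullet> (v0 + ?s *\<^sub>R u - V n) \<le> H (v0 + ?s *\<^sub>R u)"
        using Y piece_subset_domain[OF k(1) mem] subdifferential_iff by blast
      have "(T n)\<^sup>2 * (\<epsilon> * (Yn n \<bullet> u) - Yn n \<bullet> Vn n) \<le> (T n)\<^sup>2 * (\<epsilon>\<^sup>2 * (q / 2))"
        using 1 2 unfolding Hz V Yeq
        by (simp add: inner_add_left inner_add_right inner_diff_right power2_eq_square algebra_simps)
      then show ?thesis using T(1)[of n] by (simp add: mult_le_cancel_left_pos)
    qed
    have "(\<lambda>n. \<epsilon> * (Yn n \<bullet> u) - Yn n \<bullet> Vn n) \<longlonglongrightarrow> \<epsilon> * (\<eta> \<bullet> u) - \<eta> \<bullet> 0"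
      by (intro tendsto_intros lim)
    moreover have "\<forall>\<^sub>F n in sequentially. \<epsilon> * T n < 1"
      using tendsto_mult[OF tendsto_const T(2), of \<epsilon>] by (intro order_tendstoD) auto
    then have "\<forall>\<^sub>F n in sequentially. \<epsilon> * (Yn n \<bullet> u) - Yn n \<bullet> Vn n \<le> \<epsilon>\<^sup>2 * (q / 2)"
      by eventually_elim (rule ineq, simp)
    ultimately have "\<epsilon> * (\<eta> \<bullet> u) - \<eta> \<bullet> 0 \<le> \<epsilon>\<^sup>2 * (q / 2)"
      by (intro tendsto_upperbound) auto
    then show ?thesis by simp
  qed
  then have "0 \<le> - (\<eta> \<bullet> u)"
    using nonneg_of_linear_plus_quadratic[of 1 "- (\<eta> \<bullet> u)" "q / 2"] by simp
  then show ?thesis by (simp add: u_def)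
qed

text \<open>A piece cut down to a box around \<open>v0\<close> is a polytope, so only its finitely many vertices
  have to be tested.\<close>

lemma subgradient_perturbation:
  assumes y0: "y0 \<in> subdifferential h v0"
    and T: "\<And>n. T n > 0" "T \<longlonglongrightarrow> 0" and Y: "\<And>n. Y n \<in> subdifferential h (V n)"
    and V0: "(\<lambda>n. (1 / T n) *\<^sub>R (V n - v0)) \<longlonglongrightarrow> 0"
    and Y\<eta>: "(\<lambda>n. (1 / T n) *\<^sub>R (Y n - y0)) \<longlonglongrightarrow> \<eta>"
  obtains t where "t > 0" "y0 + t *\<^sub>R \<eta> \<in> subdifferential h v0"
proof -
  define A where "A = {k. k < K \<and> v0 \<in> C k}"
  define B where "B = cbox (v0 - One) (v0 + One)"
  have "\<exists>F. finite F \<and> C k \<inter> B = convex hull F" if "k \<in> A" for k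
  proof -
    have "polyhedron (C k \<inter> B)"
      using that polyhedron_piece polytope_imp_polyhedron[OF polytope_interval]
      unfolding A_def B_def by auto
    moreover have "bounded (C k \<inter> B)"
      unfolding B_def by (rule bounded_subset[OF bounded_cbox]) auto
    ultimately show ?thesis using polytope_eq_bounded_polyhedron polytope_def by metis
  qed
  then obtain F where F: "\<And>k. k \<in> A \<Longrightarrow> finite (F k)" "\<And>k. k \<in> A \<Longrightarrow> C k \<inter> B = convex hull (F k)"
    by metis
  have "\<forall>\<^sub>F t in at_right 0. (y0 + t *\<^sub>R \<eta>) \<bullet> (z - v0) \<le> piece_gradient k v0 \<bullet> (z - v0)"
    if kz: "k \<in> A" "z \<in> F k" for k z
  proof -
    have k: "k < K" "v0 \<in> C k" "z \<in> C k"
      using kz F(2)[OF kz(1)] hull_inc[of z "F k" convex] unfolding A_def by auto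
    have le: "y0 \<bullet> (z - v0) \<le> piece_gradient k v0 \<bullet> (z - v0)"
      by (rule subgradient_le_piece_gradient[OF y0 k])
    show ?thesis
    proof (cases "y0 \<bullet> (z - v0) < piece_gradient k v0 \<bullet> (z - v0)")
      case True
      have "((\<lambda>t. (y0 + t *\<^sub>R \<eta>) \<bullet> (z - v0)) \<longlongrightarrow> (y0 + 0 *\<^sub>R \<eta>) \<bullet> (z - v0)) (at_right 0)"
        by (intro tendsto_intros)
      then have "\<forall>\<^sub>F t in at_right 0. (y0 + t *\<^sub>R \<eta>) \<bullet> (z - v0) < piece_gradient k v0 \<bullet> (z - v0)"
        using True by (intro order_tendstoD) auto
      then show ?thesis by eventually_elim simp
    next
      case False
      then have eq: "piece_gradient k v0 \<bullet> (z - v0) = y0 \<bullet> (z - v0)" using le by simp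
      have "\<eta> \<bullet> (z - v0) \<le> 0"
        by (rule active_direction_bound[OF y0 T Y V0 Y\<eta> k eq])
      then have "(y0 + t *\<^sub>R \<eta>) \<bullet> (z - v0) \<le> piece_gradient k v0 \<bullet> (z - v0)" if "t > 0" for t
        using that eq by (simp add: inner_add_left mult_nonneg_nonpos)
      then show ?thesis
        by (intro eventually_mono[OF eventually_at_right_less[of "0::real"]])
    qed
  qed
  moreover have "finite A" unfolding A_def by simp
  ultimately have "\<forall>\<^sub>F t in at_right 0. \<forall>k\<in>A. \<forall>z\<in>F k.
      (y0 + t *\<^sub>R \<eta>) \<bullet> (z - v0) \<le> piece_gradient k v0 \<bullet> (z - v0)"
    using F(1) by (intro eventually_ball_finite ballI)
  then have "\<forall>\<^sub>F t in at_right 0. 0 < t \<and> (\<forall>k\<in>A. \<forall>z\<in>F k.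
      (y0 + t *\<^sub>R \<eta>) \<bullet> (z - v0) \<le> piece_gradient k v0 \<bullet> (z - v0))"
    using eventually_at_right_less[of "0::real"] by eventually_elim auto
  then obtain t where t: "0 < t" and vert: "\<And>k z. k \<in> A \<Longrightarrow> z \<in> F k \<Longrightarrow>
      (y0 + t *\<^sub>R \<eta>) \<bullet> (z - v0) \<le> piece_gradient k v0 \<bullet> (z - v0)"
    using eventually_happens[of _ "at_right (0::real)"] by force
  have "y0 + t *\<^sub>R \<eta> \<in> subdifferential h v0"
  proof (rule subdifferentialI_pieces)
    show "v0 \<in> domain h" using y0 subdifferential_iff by blast
    fix k z assume k: "k < K" "v0 \<in> C k" "z \<in> C k"
    then have kA: "k \<in> A" by (simp add: A_def)
    define a where "a = y0 + t *\<^sub>R \<eta> - piece_gradient k v0"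
    \<comment> \<open>For fixed \<open>t\<close> the inequality is affine in \<open>z\<close>, so it
      passes from the vertices to their convex hull.\<close>
    have hull: "convex hull (F k) \<subseteq> {x. a \<bullet> x \<le> a \<bullet> v0}"
    proof (intro hull_minimal convex_halfspace_le subsetI CollectI)
      show "a \<bullet> x \<le> a \<bullet> v0" if "x \<in> F k" for x
        using vert[OF kA that] by (simp add: a_def inner_diff_left inner_diff_right)
    qed
    \<comment> \<open>\<open>z\<close> may lie outside the box; contract it towards
      \<open>v0\<close>, where the inequality holds with equality, and rescale.\<close>
    have "((\<lambda>s. v0 + s *\<^sub>R (z - v0)) \<longlongrightarrow> v0 + 0 *\<^sub>R (z - v0)) (at_right 0)"
      by (intro tendsto_intros)
    then have "\<forall>\<^sub>F s in at_right 0. v0 + s *\<^sub>R (z - v0) \<in> box (v0 - One) (v0 + One)"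
      by (rule topological_tendstoD) (auto simp: mem_box inner_simps)
    moreover have "\<forall>\<^sub>F s in at_right 0. s < (1::real)"
      by (rule order_tendstoD(2)[OF tendsto_ident_at]) simp
    ultimately have "\<forall>\<^sub>F s in at_right 0. 0 < s \<and> s < 1 \<and> v0 + s *\<^sub>R (z - v0) \<in> B"
      using eventually_at_right_less[of "0::real"]
      by eventually_elim (use box_subset_cbox in \<open>auto simp: B_def\<close>)
    then obtain s where s: "0 < s" "s < 1" "v0 + s *\<^sub>R (z - v0) \<in> B"
      using eventually_happens[of _ "at_right (0::real)"] by force
    then have "v0 + s *\<^sub>R (z - v0) \<in> convex hull (F k)"
      using piece_segment[OF k, of s] F(2)[OF kA] by auto
    then have "s * (a \<bullet> (z - v0)) \<le> 0"
      using hull by (auto simp: inner_add_right)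
    then have "a \<bullet> (z - v0) \<le> 0" using s by (simp add: mult_le_0_iff)
    then show "(y0 + t *\<^sub>R \<eta>) \<bullet> (z - v0) \<le> piece_gradient k v0 \<bullet> (z - v0)"
      by (simp add: a_def inner_diff_left)
  qed
  then show ?thesis using that t by blast
qed

end

section \<open>Multipliers and the second-order condition of the composite problem\<close>

locale composite_plq = convex_plq h K C Q b \<beta>
  for h :: "real^'m \<Rightarrow> ereal" and K C Q b \<beta> +
  fixes c :: "real^'n \<Rightarrow> real^'m" and c' :: "real^'n \<Rightarrow> (real^'n) \<Rightarrow>\<^sub>L (real^'m)"
    and c'' :: "(real^'n) \<Rightarrow>\<^sub>L ((real^'n) \<Rightarrow>\<^sub>L (real^'m))" and xbar :: "real^'n"
  assumes c: "\<And>x. (c has_derivative blinfun_apply (c' x)) (at x)"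
    and c': "(c' has_derivative blinfun_apply c'') (at xbar)"
    and xbar: "c xbar \<in> domain h"
begin

lemma multipliers_iff:
  "y \<in> multipliers h c xbar \<longleftrightarrow> y \<in> subdifferential h (c xbar) \<and> (\<forall>e. y \<bullet> c' xbar e = 0)"
proof -
  have "transpose (jacobian c (at xbar)) *v y = 0 \<longleftrightarrow>
      (\<forall>e. (transpose (jacobian c (at xbar)) *v y) \<bullet> e = 0)"
    by (metis inner_eq_zero_iff inner_zero_left)
  then show ?thesis
    unfolding multipliers_def null_space_def transpose_jacobian_inner[OF c] by auto
qed

lemma tendsto_c: "X \<longlonglongrightarrow> x \<Longrightarrow> (\<lambda>n. c (X n)) \<longlonglongrightarrow> c x"
  by (rule isCont_tendsto_compose[OF has_derivative_continuous[OF c]])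

lemma tendsto_c': "X \<longlonglongrightarrow> xbar \<Longrightarrow> (\<lambda>n. c' (X n)) \<longlonglongrightarrow> c' xbar"
  by (rule isCont_tendsto_compose[OF has_derivative_continuous[OF c']])

text \<open>The second-order condition for a single multiplier, with h' and h'' read off from a
  piece containing a short ray. Directions without such a ray have h' = \<infinity> and are not in
  \<open>nonascent_dirs\<close>.\<close>

definition second_order_positive :: "real^'m \<Rightarrow> bool" where
  "second_order_positive ybar \<longleftrightarrow> (\<forall>d k s. d \<noteq> 0 \<and> k < K \<and> 0 < s \<and>
      c xbar \<in> C k \<and> c xbar + s *\<^sub>R c' xbar d \<in> C k \<and> piece_gradient k (c xbar) \<bullet> c' xbar d \<le> 0 \<longrightarrow>
      0 < c' xbar d \<bullet> (Q k *v c' xbar d) + ybar \<bullet> c'' d d)"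

lemma second_order_sufficient_iff:
  assumes M: "multipliers h c xbar = {ybar}"
  shows "second_order_sufficient h c xbar \<longleftrightarrow> second_order_positive ybar"
proof -
  have first: "0 \<in> (\<lambda>y. transpose (jacobian c (at xbar)) *v y) ` subdifferential h (c xbar)"
    using M unfolding multipliers_def null_space_def by (auto intro!: rev_image_eqI[of ybar])
  have "(\<forall>d \<in> nonascent_dirs h c xbar - {0}.
       0 < dir_deriv2 h (c xbar) (jacobian c (at xbar) *v d) + ereal (ybar \<bullet> c'' d d))
    \<longleftrightarrow> second_order_positive ybar"
    (is "?L \<longleftrightarrow> _")
  proof
    assume L: ?L
    show "second_order_positive ybar"
      unfolding second_order_positive_def
    proof (intro allI impI, elim conjE)
      fix d k s
      assume d: "d \<noteq> 0" "piece_gradient k (c xbar) \<bullet> c' xbar d \<le> 0"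
        and k: "k < K" "c xbar \<in> C k" "c xbar + s *\<^sub>R c' xbar d \<in> C k" and s: "0 < s"
      have "d \<in> nonascent_dirs h c xbar - {0}"
        using d directional_derivatives(1)[OF k s]
        unfolding nonascent_dirs_def jacobian_apply[OF c] by simp
      then show "0 < c' xbar d \<bullet> (Q k *v c' xbar d) + ybar \<bullet> c'' d d"
        using L directional_derivatives(2)[OF k s] unfolding jacobian_apply[OF c] by force
    qed
  next
    assume P: "second_order_positive ybar"
    show ?L
    proof
      fix d assume "d \<in> nonascent_dirs h c xbar - {0}"
      then have d: "d \<noteq> 0" "dir_deriv h (c xbar) (c' xbar d) \<le> 0"
        unfolding nonascent_dirs_def jacobian_apply[OF c] by auto
      then have "dir_deriv h (c xbar) (c' xbar d) < \<infinity>" by (auto intro: order_le_less_trans)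
      then obtain k s where k: "k < K" "c xbar \<in> C k" "c xbar + s *\<^sub>R c' xbar d \<in> C k" and s: "0 < s"
        using dir_deriv_less_infinity[OF xbar] by metis
      have "piece_gradient k (c xbar) \<bullet> c' xbar d \<le> 0"
        using d(2) unfolding directional_derivatives(1)[OF k s] by simp
      then have "0 < c' xbar d \<bullet> (Q k *v c' xbar d) + ybar \<bullet> c'' d d"
        using P d(1) k s unfolding second_order_positive_def by blast
      then show "0 < dir_deriv2 h (c xbar) (jacobian c (at xbar) *v d) + ereal (ybar \<bullet> c'' d d)"
        unfolding jacobian_apply[OF c] directional_derivatives(2)[OF k s] by simp
    qed
  qed
  then show ?thesis
    unfolding second_order_sufficient_def M using first by (simp add: hessian_inner[OF c c'])
qed

lemma critical_direction_from_sequence: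
  assumes V: "\<And>n. V n \<in> C k" and k: "k < K" "c xbar \<in> C k" and T: "\<And>n::nat. T n > 0"
    and W: "(\<lambda>n. (1 / T n) *\<^sub>R (V n - c xbar)) \<longlonglongrightarrow> c' xbar d" and "d \<noteq> 0"
    and crit: "piece_gradient k (c xbar) \<bullet> c' xbar d \<le> 0" and P: "second_order_positive ybar"
  shows "0 < c' xbar d \<bullet> (Q k *v c' xbar d) + ybar \<bullet> c'' d d"
proof -
  obtain s where "s > 0" "c xbar + s *\<^sub>R c' xbar d \<in> C k"
    by (rule polyhedron_tangent_direction[OF polyhedron_piece[OF k(1)] k(2) V T W])
  then show ?thesis using P k crit \<open>d \<noteq> 0\<close> unfolding second_order_positive_def by blast
qed

section \<open>Limits of violating sequences\<close>

text \<open>Dividing stationarity by \<open>T n\<close> gives the linearised equation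
  \<open>lin\<close>. Testing \<open>Y n\<close> and \<open>ybar\<close> each against the other's
  base point inside one piece gives w \<bullet> Q w \<le> \<eta> \<bullet> w, and \<open>lin\<close>
  at e = d turns the right side into minus the curvature term, against the second-order condition.
  Once d = 0, a nonzero \<eta> would lead to a second multiplier.\<close>

lemma no_subregularity_violation:
  assumes M: "multipliers h c xbar = {ybar}" and P: "second_order_positive ybar"
    and T: "\<And>n::nat. T n > 0" "T \<longlonglongrightarrow> 0" and X: "X \<longlonglongrightarrow> xbar"
    and Y: "\<And>n. Y n \<in> subdifferential h (V n)"
    and Xd: "(\<lambda>n. (1 / T n) *\<^sub>R (X n - xbar)) \<longlonglongrightarrow> d"
    and Y\<eta>: "(\<lambda>n. (1 / T n) *\<^sub>R (Y n - ybar)) \<longlonglongrightarrow> \<eta>"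
    and stat: "\<And>e. (\<lambda>n. (1 / T n) * (Y n \<bullet> c' (X n) e)) \<longlonglongrightarrow> 0"
    and feas: "(\<lambda>n. (1 / T n) *\<^sub>R (V n - c (X n))) \<longlonglongrightarrow> 0"
  shows "d = 0 \<and> \<eta> = 0"
proof -
  let ?w = "c' xbar d"
  have ybar: "ybar \<in> subdifferential h (c xbar)" "\<And>e. ybar \<bullet> c' xbar e = 0"
    using M multipliers_iff by auto
  have "(\<lambda>n. (1 / T n) *\<^sub>R (V n - c (X n)) + (1 / T n) *\<^sub>R (c (X n) - c xbar)) \<longlonglongrightarrow> 0 + ?w"
    by (intro tendsto_add feas has_derivative_seq_quotient[OF c X T(1) Xd])
  then have W: "(\<lambda>n. (1 / T n) *\<^sub>R (V n - c xbar)) \<longlonglongrightarrow> ?w"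
    by (simp add: scaleR_add_right[symmetric])
  have "(\<lambda>n. c xbar + T n *\<^sub>R ((1 / T n) *\<^sub>R (V n - c xbar))) \<longlonglongrightarrow> c xbar + 0 *\<^sub>R ?w"
    by (intro tendsto_intros T W)
  moreover have "c xbar + T n *\<^sub>R ((1 / T n) *\<^sub>R (V n - c xbar)) = V n" for n
    using T(1)[of n] by simp
  ultimately have V: "V \<longlonglongrightarrow> c xbar" by simp
  have "(\<lambda>n. ybar + T n *\<^sub>R ((1 / T n) *\<^sub>R (Y n - ybar))) \<longlonglongrightarrow> ybar + 0 *\<^sub>R \<eta>"
    by (intro tendsto_intros T Y\<eta>)
  moreover have "ybar + T n *\<^sub>R ((1 / T n) *\<^sub>R (Y n - ybar)) = Y n" for n
    using T(1)[of n] by simp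
  ultimately have Ylim: "Y \<longlonglongrightarrow> ybar" by simp
  have lin: "ybar \<bullet> c'' d e + \<eta> \<bullet> c' xbar e = 0" for e
  proof -
    have "(\<lambda>n. ybar \<bullet> ((1 / T n) *\<^sub>R (c' (X n) - c' xbar)) e + ((1 / T n) *\<^sub>R (Y n - ybar)) \<bullet> c' (X n) e)
        \<longlonglongrightarrow> ybar \<bullet> c'' d e + \<eta> \<bullet> c' xbar e"
      by (intro tendsto_intros Y\<eta> tendsto_c' X has_derivative_seq_quotient[OF c' X T(1) Xd])
    moreover have "ybar \<bullet> ((1 / T n) *\<^sub>R (c' (X n) - c' xbar)) e + ((1 / T n) *\<^sub>R (Y n - ybar)) \<bullet> c' (X n) e
        = (1 / T n) * (Y n \<bullet> c' (X n) e)" for n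
      using ybar(2)[of e]
      by (simp add: blinfun.scaleR_left blinfun.diff_left inner_diff_right inner_diff_left
          diff_divide_distrib)
    ultimately show ?thesis using stat[of e] LIMSEQ_unique by fastforce
  qed
  have "d = 0"
  proof (rule ccontr)
    assume "d \<noteq> 0"
    have "V n \<in> domain h" for n using Y subdifferential_iff by blast
    then obtain k and r :: "nat \<Rightarrow> nat" where k: "k < K" "c xbar \<in> C k" and r: "strict_mono r"
      and Vr: "\<And>n. V (r n) \<in> C k"
      by (rule sequence_in_piece[OF _ V]) blast
    define W' where "W' n = (1 / T (r n)) *\<^sub>R (V (r n) - c xbar)" for n
    define E' where "E' n = (1 / T (r n)) *\<^sub>R (Y (r n) - ybar)" for n
    have Vr_lim: "(\<lambda>n. V (r n)) \<longlonglongrightarrow> c xbar" and Yr_lim: "(\<lambda>n. Y (r n)) \<longlonglongrightarrow> ybar"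
      and W'_lim: "W' \<longlonglongrightarrow> ?w" and E'_lim: "E' \<longlonglongrightarrow> \<eta>"
      using LIMSEQ_subseq_LIMSEQ[OF V r] LIMSEQ_subseq_LIMSEQ[OF Ylim r]
        LIMSEQ_subseq_LIMSEQ[OF W r] LIMSEQ_subseq_LIMSEQ[OF Y\<eta> r]
      by (simp_all add: o_def W'_def[abs_def] E'_def[abs_def])
    let ?g = "piece_gradient k (c xbar)"
    have VW: "V (r n) = c xbar + T (r n) *\<^sub>R W' n" and YE: "Y (r n) = ybar + T (r n) *\<^sub>R E' n" for n
      using T(1)[of "r n"] by (auto simp: W'_def E'_def)
    have backward: "?g \<bullet> W' n + T (r n) * (W' n \<bullet> (Q k *v W' n)) \<le> Y (r n) \<bullet> W' n" for n
    proof -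
      have "Y (r n) \<bullet> (c xbar - V (r n)) \<le> piece_gradient k (V (r n)) \<bullet> (c xbar - V (r n))"
        by (rule subgradient_le_piece_gradient[OF Y k(1) Vr k(2)])
      then have "T (r n) * (piece_gradient k (V (r n)) \<bullet> W' n) \<le> T (r n) * (Y (r n) \<bullet> W' n)"
        unfolding VW by (simp add: inner_diff_right)
      then have "piece_gradient k (V (r n)) \<bullet> W' n \<le> Y (r n) \<bullet> W' n"
        using T(1)[of "r n"] by simp
      moreover have "piece_gradient k (V (r n)) = ?g + T (r n) *\<^sub>R (Q k *v W' n)"
        unfolding VW piece_gradient_def
        by (simp add: matrix_vector_right_distrib matrix_vector_mult_scaleR)
      ultimately show ?thesis by (simp add: inner_add_left inner_add_right inner_commute)
    qed
    have forward: "ybar \<bullet> W' n \<le> ?g \<bullet> W' n" for n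
    proof -
      have "ybar \<bullet> (V (r n) - c xbar) \<le> ?g \<bullet> (V (r n) - c xbar)"
        by (rule subgradient_le_piece_gradient[OF ybar(1) k Vr])
      then show ?thesis using T(1)[of "r n"] unfolding VW by simp
    qed
    have "T (r n) * (W' n \<bullet> (Q k *v W' n)) \<le> T (r n) * (E' n \<bullet> W' n)" for n
      using backward[of n] forward[of n] unfolding YE by (simp add: inner_add_left)
    then have "W' n \<bullet> (Q k *v W' n) \<le> E' n \<bullet> W' n" for n
      by (rule mult_left_le_imp_le[OF _ T(1)])
    moreover have Qlim: "(\<lambda>n. Q k *v W' n) \<longlonglongrightarrow> Q k *v ?w"
      by (rule isCont_tendsto_compose[OF _ W'_lim]) (simp add: matrix_vector_mult_linear_continuous_at)
    ultimately have quad: "?w \<bullet> (Q k *v ?w) \<le> \<eta> \<bullet> ?w"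
      by (intro LIMSEQ_le[OF tendsto_inner[OF W'_lim Qlim] tendsto_inner[OF E'_lim W'_lim]]) auto
    \<comment> \<open>Criticality of \<open>d\<close>: the limit of \<open>backward\<close>, in
      which \<open>Y\<close> tends to \<open>ybar\<close>, and \<open>ybar\<close> annihilates
      \<open>?w\<close>.\<close>
    have "?g \<bullet> ?w + 0 * (?w \<bullet> (Q k *v ?w)) \<le> ybar \<bullet> ?w"
    proof (rule LIMSEQ_le)
      show "(\<lambda>n. ?g \<bullet> W' n + T (r n) * (W' n \<bullet> (Q k *v W' n))) \<longlonglongrightarrow> ?g \<bullet> ?w + 0 * (?w \<bullet> (Q k *v ?w))"
        using LIMSEQ_subseq_LIMSEQ[OF T(2) r]
        by (intro tendsto_intros W'_lim Qlim) (simp add: o_def)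
      show "(\<lambda>n. Y (r n) \<bullet> W' n) \<longlonglongrightarrow> ybar \<bullet> ?w"
        by (intro tendsto_intros W'_lim Yr_lim)
    qed (use backward in auto)
    then have "?g \<bullet> ?w \<le> 0" using ybar(2) by simp
    then have "0 < ?w \<bullet> (Q k *v ?w) + ybar \<bullet> c'' d d"
      by (intro critical_direction_from_sequence[where V = "\<lambda>n. V (r n)" and T = "\<lambda>n. T (r n)", OF Vr k])
        (use T W'_lim[unfolded W'_def[abs_def]] \<open>d \<noteq> 0\<close> P in auto)
    then show False using quad lin[of d] by simp
  qed
  moreover have "\<eta> = 0"
  proof (rule ccontr)
    assume "\<eta> \<noteq> 0"
    \<comment> \<open>With d = 0 the points \<open>V n\<close> approach \<open>c xbar\<close> faster
      than \<open>T n\<close>, as \<open>subgradient_perturbation\<close> requires.\<close>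
    have "(\<lambda>n. (1 / T n) *\<^sub>R (V n - c xbar)) \<longlonglongrightarrow> 0" using W \<open>d = 0\<close> by simp
    then obtain t where t: "t > 0" "ybar + t *\<^sub>R \<eta> \<in> subdifferential h (c xbar)"
      by (rule subgradient_perturbation[OF ybar(1) T Y _ Y\<eta>])
    then have "ybar + t *\<^sub>R \<eta> \<in> multipliers h c xbar"
      using lin ybar(2) \<open>d = 0\<close> by (simp add: multipliers_iff inner_add_left)
    then show False using M t \<open>\<eta> \<noteq> 0\<close> by simp
  qed
  ultimately show ?thesis by simp
qed

text \<open>Division by \<open>T n\<close> yields criticality. Before dividing by its square, the
  linear term is bounded below through \<open>ybar\<close>, which annihilates the first-order part
  of \<open>c\<close> and leaves only its curvature.\<close>

lemma no_growth_violation: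
  assumes M: "multipliers h c xbar = {ybar}" and P: "second_order_positive ybar"
    and T: "\<And>n::nat. T n > 0" and X: "X \<longlonglongrightarrow> xbar" and dom: "\<And>n. c (X n) \<in> domain h"
    and Xd: "(\<lambda>n. (1 / T n) *\<^sub>R (X n - xbar)) \<longlonglongrightarrow> d"
    and \<epsilon>: "\<epsilon> \<longlonglongrightarrow> 0" and T0: "T \<longlonglongrightarrow> 0"
    and le: "\<And>n. H (c (X n)) \<le> H (c xbar) + \<epsilon> n * (T n)\<^sup>2"
  shows "d = 0"
proof (rule ccontr)
  assume "d \<noteq> 0"
  let ?w = "c' xbar d"
  have ybar: "ybar \<in> subdifferential h (c xbar)" "\<And>e. ybar \<bullet> c' xbar e = 0"
    using M multipliers_iff by auto
  obtain k and r :: "nat \<Rightarrow> nat" where k: "k < K" "c xbar \<in> C k" and r: "strict_mono r"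
    and Vr: "\<And>n. c (X (r n)) \<in> C k"
    by (rule sequence_in_piece[OF dom tendsto_c[OF X]]) blast
  let ?g = "piece_gradient k (c xbar)"
  define S where "S n = T (r n)" for n
  define Z where "Z n = X (r n)" for n
  define W where "W n = (1 / S n) *\<^sub>R (c (Z n) - c xbar)" for n
  define A where "A n = (1 / (S n)\<^sup>2) *\<^sub>R (c (Z n) - c xbar - c' xbar (Z n - xbar))" for n
  have S: "S n > 0" for n by (simp add: S_def T)
  have Z: "Z \<longlonglongrightarrow> xbar" and S0: "S \<longlonglongrightarrow> 0" and \<epsilon>0: "(\<lambda>n. \<epsilon> (r n)) \<longlonglongrightarrow> 0"
    and Zd: "(\<lambda>n. (1 / S n) *\<^sub>R (Z n - xbar)) \<longlonglongrightarrow> d"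
    using LIMSEQ_subseq_LIMSEQ[OF X r] LIMSEQ_subseq_LIMSEQ[OF T0 r] LIMSEQ_subseq_LIMSEQ[OF \<epsilon> r]
      LIMSEQ_subseq_LIMSEQ[OF Xd r]
    by (simp_all add: o_def Z_def[abs_def] S_def[abs_def])
  have W: "W \<longlonglongrightarrow> ?w"
    unfolding W_def by (rule has_derivative_seq_quotient[OF c Z S Zd])
  have A: "A \<longlonglongrightarrow> (1/2) *\<^sub>R c'' d d"
    unfolding A_def by (rule second_order_seq_quotient[OF c c' Z S Zd])
  have Q: "(\<lambda>n. Q k *v W n) \<longlonglongrightarrow> Q k *v ?w"
    by (rule isCont_tendsto_compose[OF _ W]) (simp add: matrix_vector_mult_linear_continuous_at)
  have cW: "c (Z n) = c xbar + S n *\<^sub>R W n" for n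
    using S[of n] by (simp add: W_def)
  have HZ: "H (c (Z n)) = H (c xbar) + S n * (?g \<bullet> W n) + (S n)\<^sup>2 * (W n \<bullet> (Q k *v W n) / 2)" for n
    using H_expand[OF k Vr[of n, folded Z_def]] unfolding cW
    by (simp add: matrix_vector_mult_scaleR power2_eq_square)
  have main: "S n * (?g \<bullet> W n) + (S n)\<^sup>2 * (W n \<bullet> (Q k *v W n) / 2) \<le> (S n)\<^sup>2 * \<epsilon> (r n)" for n
    using le[of "r n"] HZ[of n] by (simp add: Z_def S_def mult.commute)
  have "S n * (?g \<bullet> W n + S n * (W n \<bullet> (Q k *v W n) / 2)) \<le> S n * (S n * \<epsilon> (r n))" for n
    using main[of n] by (simp add: algebra_simps power2_eq_square)
  then have first: "?g \<bullet> W n + S n * (W n \<bullet> (Q k *v W n) / 2) \<le> S n * \<epsilon> (r n)" for n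
    by (rule mult_left_le_imp_le[OF _ S])
  have "?g \<bullet> ?w + 0 * (?w \<bullet> (Q k *v ?w) / 2) \<le> 0 * 0"
  proof (rule LIMSEQ_le)
    show "(\<lambda>n. ?g \<bullet> W n + S n * (W n \<bullet> (Q k *v W n) / 2)) \<longlonglongrightarrow> ?g \<bullet> ?w + 0 * (?w \<bullet> (Q k *v ?w) / 2)"
      by (intro tendsto_intros S0 W Q) simp
    show "(\<lambda>n. S n * \<epsilon> (r n)) \<longlonglongrightarrow> 0 * 0" by (intro tendsto_mult S0 \<epsilon>0)
  qed (use first in auto)
  then have crit: "?g \<bullet> ?w \<le> 0" by simp
  have pos: "0 < ?w \<bullet> (Q k *v ?w) + ybar \<bullet> c'' d d"
    by (rule critical_direction_from_sequence[OF Vr k, of S])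
      (use S W \<open>d \<noteq> 0\<close> P crit in \<open>auto simp: W_def[abs_def] Z_def\<close>)
  have "(S n)\<^sup>2 * (ybar \<bullet> A n + W n \<bullet> (Q k *v W n) / 2) \<le> (S n)\<^sup>2 * \<epsilon> (r n)" for n
  proof -
    have "ybar \<bullet> (c (Z n) - c xbar) \<le> ?g \<bullet> (c (Z n) - c xbar)"
      by (rule subgradient_le_piece_gradient[OF ybar(1) k]) (simp add: Z_def Vr)
    moreover have "(S n)\<^sup>2 * (ybar \<bullet> A n) = ybar \<bullet> (c (Z n) - c xbar)"
      using S[of n] ybar(2) by (simp add: A_def inner_diff_right)
    moreover have "?g \<bullet> (c (Z n) - c xbar) = S n * (?g \<bullet> W n)" by (simp add: cW)
    ultimately show ?thesis using main[of n] by (simp add: distrib_left)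
  qed
  then have le2: "ybar \<bullet> A n + W n \<bullet> (Q k *v W n) / 2 \<le> \<epsilon> (r n)" for n
    by (rule mult_left_le_imp_le[OF _ zero_less_power[OF S]])
  have "ybar \<bullet> ((1/2) *\<^sub>R c'' d d) + ?w \<bullet> (Q k *v ?w) / 2 \<le> 0"
  proof (rule LIMSEQ_le[OF _ \<epsilon>0])
    show "(\<lambda>n. ybar \<bullet> A n + W n \<bullet> (Q k *v W n) / 2)
        \<longlonglongrightarrow> ybar \<bullet> ((1/2) *\<^sub>R c'' d d) + ?w \<bullet> (Q k *v ?w) / 2"
      by (intro tendsto_intros A W Q) simp
  qed (use le2 in auto)
  then show False using pos by simp
qed

end

section \<open>Subregularity, quadratic growth and accumulation of multipliers\<close>

lemma norm_fst_snd_le: "norm u \<le> norm (u, w)" "norm w \<le> norm (u, w)"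
  using norm_fst_le[of u w] norm_snd_le[of w u] by auto

context composite_plq
begin

text \<open>Norm of the element of (g + G)(x, y) that belongs to the point \<open>v\<close>; its
  membership is imposed separately, as \<open>y \<in> subdifferential h v\<close>.\<close>

definition kkt_residual :: "real^'n \<Rightarrow> real^'m \<Rightarrow> real^'m \<Rightarrow> real" where
  "kkt_residual x y v = norm (transpose (jacobian c (at x)) *v y, v - c x)"

lemma subregular_of_second_order:
  assumes M: "multipliers h c xbar = {ybar}" and P: "second_order_positive ybar"
  shows "\<exists>\<kappa>>0. \<exists>\<delta>>0. \<forall>x y v. y \<in> subdifferential h v \<longrightarrow> norm (x - xbar, y - ybar) < \<delta> \<longrightarrow>
      norm (x - xbar, y - ybar) \<le> \<kappa> * kkt_residual x y v"
proof (rule ccontr)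
  assume neg: "\<not> ?thesis"
  \<comment> \<open>\<open>Suc n\<close> serves as the modulus and its inverse as the
    radius.\<close>
  have "\<exists>x y v. y \<in> subdifferential h v \<and> norm (x - xbar, y - ybar) < inverse (real (Suc n)) \<and>
      real (Suc n) * kkt_residual x y v < norm (x - xbar, y - ybar)" for n
  proof (rule ccontr)
    assume "\<not> ?thesis"
    then have "\<forall>x y v. y \<in> subdifferential h v \<longrightarrow> norm (x - xbar, y - ybar) < inverse (real (Suc n)) \<longrightarrow>
        norm (x - xbar, y - ybar) \<le> real (Suc n) * kkt_residual x y v"
      by (meson not_le)
    moreover have "real (Suc n) > 0" "inverse (real (Suc n)) > 0" by auto
    ultimately show False using neg by blast
  qed
  then obtain X Y V where Y: "\<And>n. Y n \<in> subdifferential h (V n)"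
    and small: "\<And>n. norm (X n - xbar, Y n - ybar) < inverse (real (Suc n))"
    and res: "\<And>n. real (Suc n) * kkt_residual (X n) (Y n) (V n) < norm (X n - xbar, Y n - ybar)"
    by metis
  define T where "T n = norm (X n - xbar, Y n - ybar)" for n
  have T: "T n > 0" for n
  proof -
    have "0 \<le> real (Suc n) * kkt_residual (X n) (Y n) (V n)" by (simp add: kkt_residual_def)
    then show ?thesis using res[of n] unfolding T_def by linarith
  qed
  have T0: "T \<longlonglongrightarrow> 0"
    by (rule tendsto_sandwich[OF _ _ tendsto_const LIMSEQ_inverse_real_of_nat])
      (use T small in \<open>auto simp: T_def less_imp_le\<close>)
  have R0: "(\<lambda>n. kkt_residual (X n) (Y n) (V n) / T n) \<longlonglongrightarrow> 0"
  proof (rule tendsto_sandwich[OF _ _ tendsto_const LIMSEQ_inverse_real_of_nat])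
    show "\<forall>\<^sub>F n in sequentially. kkt_residual (X n) (Y n) (V n) / T n \<le> inverse (real (Suc n))"
    proof (intro always_eventually allI)
      fix n
      have "real (Suc n) * (kkt_residual (X n) (Y n) (V n) / T n) \<le> 1"
        using res[of n] T[of n] by (simp add: T_def)
      then show "kkt_residual (X n) (Y n) (V n) / T n \<le> inverse (real (Suc n))"
        by (simp add: field_simps)
    qed
    show "\<forall>\<^sub>F n in sequentially. 0 \<le> kkt_residual (X n) (Y n) (V n) / T n"
      using T by (simp add: kkt_residual_def less_imp_le)
  qed
  define D where "D n = (1 / T n) *\<^sub>R (X n - xbar, Y n - ybar)" for n
  have Dnorm: "norm (D n) = 1" for n
    using T[of n] unfolding D_def norm_scaleR T_def[symmetric] by simp
  then have "\<forall>n. D n \<in> sphere 0 1" by simp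
  then obtain p r where r: "strict_mono (r :: nat \<Rightarrow> nat)" and p: "(D \<circ> r) \<longlonglongrightarrow> p"
    using compact_sphere[of "0 :: (real^'n) \<times> (real^'m)" 1] unfolding compact_def by metis
  obtain d \<eta> where p_eq: "p = (d, \<eta>)" by (cases p)
  have Tr0: "(\<lambda>n. T (r n)) \<longlonglongrightarrow> 0" using LIMSEQ_subseq_LIMSEQ[OF T0 r] by (simp add: o_def)
  have Rr0: "(\<lambda>n. kkt_residual (X (r n)) (Y (r n)) (V (r n)) / T (r n)) \<longlonglongrightarrow> 0"
    using LIMSEQ_subseq_LIMSEQ[OF R0 r] by (simp add: o_def)
  have Xd: "(\<lambda>n. (1 / T (r n)) *\<^sub>R (X (r n) - xbar)) \<longlonglongrightarrow> d"
    and Y\<eta>: "(\<lambda>n. (1 / T (r n)) *\<^sub>R (Y (r n) - ybar)) \<longlonglongrightarrow> \<eta>"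
    using tendsto_fst[OF p] tendsto_snd[OF p] by (simp_all add: D_def o_def p_eq)
  have "(\<lambda>n. norm (X (r n) - xbar)) \<longlonglongrightarrow> 0"
    by (rule tendsto_sandwich[OF _ _ tendsto_const Tr0])
      (auto simp: T_def norm_fst_snd_le)
  then have X: "(\<lambda>n. X (r n)) \<longlonglongrightarrow> xbar"
    using tendsto_norm_zero_iff LIM_zero_iff by blast
  have "d = 0 \<and> \<eta> = 0"
  proof (rule no_subregularity_violation[OF M P T Tr0 X Y Xd Y\<eta>])
    fix e
    show "(\<lambda>n. (1 / T (r n)) * (Y (r n) \<bullet> c' (X (r n)) e)) \<longlonglongrightarrow> 0"
    proof (rule Lim_null_comparison)
      show "(\<lambda>n. kkt_residual (X (r n)) (Y (r n)) (V (r n)) / T (r n) * norm e) \<longlonglongrightarrow> 0"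
        using tendsto_mult[OF Rr0 tendsto_const, of "norm e"] by simp
      show "\<forall>\<^sub>F n in sequentially. norm ((1 / T (r n)) * (Y (r n) \<bullet> c' (X (r n)) e))
          \<le> kkt_residual (X (r n)) (Y (r n)) (V (r n)) / T (r n) * norm e"
      proof (intro always_eventually allI)
        fix n
        let ?J = "transpose (jacobian c (at (X (r n)))) *v Y (r n)"
        have "\<bar>Y (r n) \<bullet> c' (X (r n)) e\<bar> \<le> norm ?J * norm e"
          unfolding transpose_jacobian_inner[OF c, symmetric] by (rule Cauchy_Schwarz_ineq2)
        also have "\<dots> \<le> kkt_residual (X (r n)) (Y (r n)) (V (r n)) * norm e"
          unfolding kkt_residual_def by (intro mult_right_mono norm_fst_snd_le) simp
        finally have "\<bar>Y (r n) \<bullet> c' (X (r n)) e\<bar> / T (r n)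
            \<le> kkt_residual (X (r n)) (Y (r n)) (V (r n)) * norm e / T (r n)"
          using T[of "r n"] by (intro divide_right_mono) auto
        then show "norm ((1 / T (r n)) * (Y (r n) \<bullet> c' (X (r n)) e))
            \<le> kkt_residual (X (r n)) (Y (r n)) (V (r n)) / T (r n) * norm e"
          using T[of "r n"] by (simp add: abs_mult)
      qed
    qed
  next
    show "(\<lambda>n. (1 / T (r n)) *\<^sub>R (V (r n) - c (X (r n)))) \<longlonglongrightarrow> 0"
    proof (rule Lim_null_comparison[OF _ Rr0])
      show "\<forall>\<^sub>F n in sequentially. norm ((1 / T (r n)) *\<^sub>R (V (r n) - c (X (r n))))
          \<le> kkt_residual (X (r n)) (Y (r n)) (V (r n)) / T (r n)"
        using T by (auto simp: kkt_residual_def norm_fst_snd_le divide_right_mono less_imp_le)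
    qed
  qed
  then have "p = 0" by (simp add: p_eq zero_prod_def)
  moreover have "norm p = 1"
    using tendsto_norm[OF p] by (simp add: o_def Dnorm LIMSEQ_const_iff)
  ultimately show False by simp
qed

lemma quadratic_growth_of_second_order:
  assumes M: "multipliers h c xbar = {ybar}" and P: "second_order_positive ybar"
  shows "\<exists>\<gamma>>0. \<exists>\<delta>>0. \<forall>x. norm (x - xbar) < \<delta> \<longrightarrow> c x \<in> domain h \<longrightarrow>
      H (c xbar) + \<gamma> * (norm (x - xbar))\<^sup>2 \<le> H (c x)"
proof (rule ccontr)
  assume neg: "\<not> ?thesis"
  have "\<exists>x. norm (x - xbar) < inverse (real (Suc n)) \<and> c x \<in> domain h \<and>
      H (c x) < H (c xbar) + inverse (real (Suc n)) * (norm (x - xbar))\<^sup>2" for n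
  proof (rule ccontr)
    assume "\<not> ?thesis"
    then have "\<forall>x. norm (x - xbar) < inverse (real (Suc n)) \<longrightarrow> c x \<in> domain h \<longrightarrow>
        H (c xbar) + inverse (real (Suc n)) * (norm (x - xbar))\<^sup>2 \<le> H (c x)"
      by (meson not_le)
    moreover have "inverse (real (Suc n)) > 0" by auto
    ultimately show False using neg by blast
  qed
  then obtain X where small: "\<And>n. norm (X n - xbar) < inverse (real (Suc n))"
    and dom: "\<And>n. c (X n) \<in> domain h"
    and less: "\<And>n. H (c (X n)) < H (c xbar) + inverse (real (Suc n)) * (norm (X n - xbar))\<^sup>2"
    by metis
  define T where "T n = norm (X n - xbar)" for n
  have T: "T n > 0" for n
    using less[of n] by (cases "X n = xbar") (auto simp: T_def)
  have T0: "T \<longlonglongrightarrow> 0"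
    by (rule tendsto_sandwich[OF _ _ tendsto_const LIMSEQ_inverse_real_of_nat])
      (use T small in \<open>auto simp: T_def less_imp_le\<close>)
  define D where "D n = (1 / T n) *\<^sub>R (X n - xbar)" for n
  have Dnorm: "norm (D n) = 1" for n
    using T[of n] unfolding D_def norm_scaleR T_def[symmetric] by simp
  then have "\<forall>n. D n \<in> sphere 0 1" by simp
  then obtain d r where r: "strict_mono (r :: nat \<Rightarrow> nat)" and d: "(D \<circ> r) \<longlonglongrightarrow> d"
    using compact_sphere[of "0 :: real^'n" 1] unfolding compact_def by metis
  have X: "(\<lambda>n. X (r n)) \<longlonglongrightarrow> xbar"
    using LIMSEQ_subseq_LIMSEQ[OF T0 r] tendsto_norm_zero_iff[of "\<lambda>n. X (r n) - xbar"] LIM_zero_iff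
    by (simp add: o_def T_def[abs_def] LIM_zero_iff)
  have "d = 0"
  proof (rule no_growth_violation[OF M P, of "\<lambda>n. T (r n)" "\<lambda>n. X (r n)" d "\<lambda>n. inverse (real (Suc (r n)))"])
    show "(\<lambda>n. (1 / T (r n)) *\<^sub>R (X (r n) - xbar)) \<longlonglongrightarrow> d"
      using d by (simp add: D_def o_def)
    show "(\<lambda>n. inverse (real (Suc (r n)))) \<longlonglongrightarrow> 0" "(\<lambda>n. T (r n)) \<longlonglongrightarrow> 0"
      using LIMSEQ_subseq_LIMSEQ[OF LIMSEQ_inverse_real_of_nat r] LIMSEQ_subseq_LIMSEQ[OF T0 r]
      by (simp_all add: o_def)
    show "H (c (X (r n))) \<le> H (c xbar) + inverse (real (Suc (r n))) * (T (r n))\<^sup>2" for n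
      using less[of "r n"] by (simp add: T_def)
  qed (use T X dom in auto)
  moreover have "norm d = 1"
    using tendsto_norm[OF d] by (simp add: o_def Dnorm LIMSEQ_const_iff)
  ultimately show False by simp
qed

text \<open>No bound on \<open>Y n\<close> is needed: by convexity the points \<open>(1 - \<theta>) ybar + \<theta> Y n\<close> at distance
  \<open>\<epsilon>\<close> from \<open>ybar\<close> are approximate subgradients, and they accumulate at another multiplier.\<close>

lemma another_multiplier:
  assumes ybar: "ybar \<in> multipliers h c xbar" and X: "X \<longlonglongrightarrow> xbar" and V: "V \<longlonglongrightarrow> c xbar"
    and Y: "\<And>n::nat. Y n \<in> subdifferential h (V n)"
    and stat: "\<And>e. (\<lambda>n. Y n \<bullet> c' (X n) e) \<longlonglongrightarrow> 0"
    and \<epsilon>: "0 < \<epsilon>" and far: "\<And>n. \<epsilon> \<le> norm (Y n - ybar)"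
  shows "\<exists>y\<in>multipliers h c xbar. y \<noteq> ybar"
proof -
  have yb: "ybar \<in> subdifferential h (c xbar)" "\<And>e. ybar \<bullet> c' xbar e = 0"
    using ybar multipliers_iff by auto
  define N where "N n = norm (Y n - ybar)" for n
  have N: "N n \<ge> \<epsilon>" "N n > 0" for n using far[of n] \<epsilon> by (auto simp: N_def)
  define D where "D n = (1 / N n) *\<^sub>R (Y n - ybar)" for n
  have Dnorm: "norm (D n) = 1" for n
    using N(2)[of n] unfolding D_def norm_scaleR N_def[symmetric] by simp
  then have "\<forall>n. D n \<in> sphere 0 1" by simp
  then obtain u r where r: "strict_mono (r :: nat \<Rightarrow> nat)" and u: "(D \<circ> r) \<longlonglongrightarrow> u"
    using compact_sphere[of "0 :: real^'m" 1] unfolding compact_def by metis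
  have u: "(\<lambda>n. D (r n)) \<longlonglongrightarrow> u" using u by (simp add: o_def)
  have Xr: "(\<lambda>n. X (r n)) \<longlonglongrightarrow> xbar" and Vr: "(\<lambda>n. V (r n)) \<longlonglongrightarrow> c xbar"
    using LIMSEQ_subseq_LIMSEQ[OF X r] LIMSEQ_subseq_LIMSEQ[OF V r] by (simp_all add: o_def)
  have "norm u = 1"
    using tendsto_norm[OF u] by (simp add: Dnorm LIMSEQ_const_iff)
  have "ybar + \<epsilon> *\<^sub>R u \<in> subdifferential h (c xbar)"
    unfolding subdifferential_iff
  proof (intro conjI ballI xbar)
    fix z assume z: "z \<in> domain h"
    have "H (c xbar) + (ybar \<bullet> (z - c xbar) + \<epsilon> * (D n \<bullet> (z - V n))) \<le> H z" for n
    proof -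
      define \<theta> where "\<theta> = \<epsilon> / N n"
      have \<theta>: "0 \<le> \<theta>" "0 \<le> 1 - \<theta>" using \<epsilon> N[of n] by (auto simp: \<theta>_def)
      have "V n \<in> domain h" "H (V n) + Y n \<bullet> (z - V n) \<le> H z"
        using Y[of n] z subdifferential_iff by auto
      moreover have "H (c xbar) + ybar \<bullet> (V n - c xbar) \<le> H (V n)"
        using yb(1) \<open>V n \<in> domain h\<close> subdifferential_iff by auto
      \<comment> \<open>The inequality of \<open>ybar\<close> at \<open>V n\<close> replaces
        \<open>H (V n)\<close> by its affine bound from \<open>c xbar\<close>; only the increment
        \<open>Y n - ybar\<close> stays attached to \<open>V n\<close>.\<close>
      ultimately have 1: "H (c xbar) + ybar \<bullet> (z - c xbar) + (Y n - ybar) \<bullet> (z - V n) \<le> H z"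
        by (simp add: inner_diff_left inner_diff_right)
      have 2: "H (c xbar) + ybar \<bullet> (z - c xbar) \<le> H z"
        using yb(1) z subdifferential_iff by auto
      have "\<theta> * (H (c xbar) + ybar \<bullet> (z - c xbar) + (Y n - ybar) \<bullet> (z - V n))
          + (1 - \<theta>) * (H (c xbar) + ybar \<bullet> (z - c xbar)) \<le> \<theta> * H z + (1 - \<theta>) * H z"
        by (intro add_mono mult_left_mono 1 2 \<theta>)
      moreover have "\<theta> * ((Y n - ybar) \<bullet> (z - V n)) = \<epsilon> * (D n \<bullet> (z - V n))"
        by (simp add: \<theta>_def D_def)
      ultimately show ?thesis by (simp add: algebra_simps)
    qed
    then have ineq: "H (c xbar) + (ybar \<bullet> (z - c xbar) + \<epsilon> * (D (r n) \<bullet> (z - V (r n)))) \<le> H z" for n .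
    have "(\<lambda>n. H (c xbar) + (ybar \<bullet> (z - c xbar) + \<epsilon> * (D (r n) \<bullet> (z - V (r n)))))
        \<longlonglongrightarrow> H (c xbar) + (ybar \<bullet> (z - c xbar) + \<epsilon> * (u \<bullet> (z - c xbar)))"
      by (intro tendsto_intros u Vr)
    then have "H (c xbar) + (ybar \<bullet> (z - c xbar) + \<epsilon> * (u \<bullet> (z - c xbar))) \<le> H z"
      by (rule LIMSEQ_le_const2) (use ineq in auto)
    then show "H (c xbar) + (ybar + \<epsilon> *\<^sub>R u) \<bullet> (z - c xbar) \<le> H z"
      by (simp add: inner_add_left)
  qed
  moreover have "u \<bullet> c' xbar e = 0" for e
  proof -
    have "(\<lambda>n. (Y n \<bullet> c' (X n) e) - ybar \<bullet> c' (X n) e) \<longlonglongrightarrow> 0 - ybar \<bullet> c' xbar e"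
      by (intro tendsto_intros stat tendsto_c' X)
    then have lim: "(\<lambda>n. (1 / \<epsilon>) * ((Y n \<bullet> c' (X n) e) - ybar \<bullet> c' (X n) e)) \<longlonglongrightarrow> 0"
      using yb(2)[of e] tendsto_mult_right_zero by fastforce
    have "(\<lambda>n. D n \<bullet> c' (X n) e) \<longlonglongrightarrow> 0"
    proof (rule Lim_null_comparison)
      show "(\<lambda>n. \<bar>(1 / \<epsilon>) * ((Y n \<bullet> c' (X n) e) - ybar \<bullet> c' (X n) e)\<bar>) \<longlonglongrightarrow> 0"
        using tendsto_rabs_zero[OF lim] .
      show "\<forall>\<^sub>F n in sequentially. norm (D n \<bullet> c' (X n) e)
          \<le> \<bar>(1 / \<epsilon>) * ((Y n \<bullet> c' (X n) e) - ybar \<bullet> c' (X n) e)\<bar>"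
      proof (intro always_eventually allI)
        fix n
        \<comment> \<open>\<open>N n\<close> may be unbounded, but large values only help: 1 / N n
          is at most 1 / \<epsilon>.\<close>
        have "\<bar>1 / N n\<bar> * \<bar>(Y n - ybar) \<bullet> c' (X n) e\<bar> \<le> \<bar>1 / \<epsilon>\<bar> * \<bar>(Y n - ybar) \<bullet> c' (X n) e\<bar>"
          using N[of n] \<epsilon> by (intro mult_right_mono) (auto simp: field_simps)
        then show "norm (D n \<bullet> c' (X n) e) \<le> \<bar>(1 / \<epsilon>) * ((Y n \<bullet> c' (X n) e) - ybar \<bullet> c' (X n) e)\<bar>"
          unfolding D_def by (simp add: abs_mult inner_diff_left)
      qed
    qed
    from LIMSEQ_subseq_LIMSEQ[OF this r]
    have "(\<lambda>n. D (r n) \<bullet> c' (X (r n)) e) \<longlonglongrightarrow> 0" by (simp add: o_def)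
    moreover have "(\<lambda>n. D (r n) \<bullet> c' (X (r n)) e) \<longlonglongrightarrow> u \<bullet> c' xbar e"
      by (intro tendsto_intros u tendsto_c' Xr)
    ultimately show ?thesis using LIMSEQ_unique by blast
  qed
  ultimately have "ybar + \<epsilon> *\<^sub>R u \<in> multipliers h c xbar"
    using yb(2) by (simp add: multipliers_iff inner_add_left)
  moreover have "ybar + \<epsilon> *\<^sub>R u \<noteq> ybar" using \<epsilon> \<open>norm u = 1\<close> by auto
  ultimately show ?thesis by blast
qed

section \<open>The tilted augmented Lagrangian\<close>

definition augmented :: "real^'m \<Rightarrow> real \<Rightarrow> real^'n \<Rightarrow> real^'m \<Rightarrow> real" where
  "augmented y r x v = H v + y \<bullet> (c x - v) + r/2 * ((c x - v) \<bullet> (c x - v))"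

text \<open>Move \<open>v\<close> along segments towards points of the domain, where convexity
  bounds the change of \<open>H\<close>; the strict bound keeps short moves inside the ball. The
  subgradient found is the usual multiplier update.\<close>

lemma augmented_stationary_v:
  assumes v: "v \<in> domain h" and \<rho>: "norm (v - c xbar) < \<rho>"
    and min: "\<And>v'. v' \<in> domain h \<Longrightarrow> norm (v' - c xbar) \<le> \<rho> \<Longrightarrow> augmented y r x v \<le> augmented y r x v'"
  shows "y + r *\<^sub>R (c x - v) \<in> subdifferential h v"
  unfolding subdifferential_iff
proof (intro conjI ballI v)
  fix z assume z: "z \<in> domain h"
  define u where "u = z - v"
  define p where "p = c x - v"
  have "((\<lambda>t. norm (v + t *\<^sub>R u - c xbar)) \<longlongrightarrow> norm (v + 0 *\<^sub>R u - c xbar)) (at_right 0)"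
    by (intro tendsto_intros)
  then have "\<forall>\<^sub>F t in at_right 0. norm (v + t *\<^sub>R u - c xbar) < \<rho>"
    using \<rho> by (intro order_tendstoD) auto
  then obtain s0 where s0: "s0 > 0" "\<And>t. 0 < t \<Longrightarrow> t < s0 \<Longrightarrow> norm (v + t *\<^sub>R u - c xbar) < \<rho>"
    unfolding eventually_at_right_field by auto
  have "0 \<le> H z - H v - (y + r *\<^sub>R (c x - v)) \<bullet> u"
  proof (rule nonneg_of_linear_plus_quadratic[of "min 1 s0"])
    fix t assume t: "0 < t" "t < min 1 s0"
    have conv: "v + t *\<^sub>R u \<in> domain h" "H (v + t *\<^sub>R u) \<le> H v + t * (H z - H v)"
      using H_convex[OF v z, of t] t by (auto simp: u_def)
    have "augmented y r x v \<le> augmented y r x (v + t *\<^sub>R u)"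
      using min[OF conv(1)] s0(2)[of t] t by simp
    moreover have "c x - (v + t *\<^sub>R u) = p - t *\<^sub>R u" by (simp add: p_def)
    moreover have "(p - t *\<^sub>R u) \<bullet> (p - t *\<^sub>R u) = p \<bullet> p - 2 * t * (p \<bullet> u) + t\<^sup>2 * (u \<bullet> u)"
      by (simp add: inner_diff_left inner_diff_right inner_commute power2_eq_square)
    ultimately have "H v + y \<bullet> p + r/2 * (p \<bullet> p) \<le> H v + t * (H z - H v) + y \<bullet> (p - t *\<^sub>R u)
        + r/2 * (p \<bullet> p - 2 * t * (p \<bullet> u) + t\<^sup>2 * (u \<bullet> u))"
      using conv(2) unfolding augmented_def p_def[symmetric] by simp
    then show "0 \<le> t * (H z - H v - (y + r *\<^sub>R (c x - v)) \<bullet> u) + t\<^sup>2 * (r/2 * (u \<bullet> u))"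
      unfolding p_def[symmetric] by (simp add: inner_add_left inner_diff_right algebra_simps)
  qed (use s0 in auto)
  then show "H v + (y + r *\<^sub>R (c x - v)) \<bullet> (z - v) \<le> H z" by (simp add: u_def)
qed

text \<open>Fermat's rule inside the ball. The same updated multiplier appears as in the condition
  on \<open>v\<close>, so the two form a KKT system whose residual consists of the tilt 2 \<mu> (x -
  xbar) and the defect v - c x.\<close>

lemma augmented_stationary_x:
  assumes \<rho>: "norm (x - xbar) < \<rho>"
    and min: "\<And>x'. norm (x' - xbar) \<le> \<rho> \<Longrightarrow>
      augmented y r x v - \<mu> * ((x - xbar) \<bullet> (x - xbar)) \<le> augmented y r x' v - \<mu> * ((x' - xbar) \<bullet> (x' - xbar))"
  shows "(y + r *\<^sub>R (c x - v)) \<bullet> c' x e = 2 * \<mu> * ((x - xbar) \<bullet> e)"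
proof -
  let ?F = "\<lambda>x. augmented y r x v - \<mu> * ((x - xbar) \<bullet> (x - xbar))"
  let ?F' = "\<lambda>e. (y + r *\<^sub>R (c x - v)) \<bullet> c' x e - 2 * \<mu> * ((x - xbar) \<bullet> e)"
  have "(?F has_derivative ?F') (at x)"
    unfolding augmented_def
    by (rule derivative_eq_intros c refl)+
      (simp add: fun_eq_iff inner_add_left inner_commute algebra_simps)
  moreover have "?F x \<le> ?F x'" if "x' \<in> ball xbar \<rho>" for x'
    using that by (intro min) (simp add: dist_norm norm_minus_commute)
  moreover have "x \<in> ball xbar \<rho>" using \<rho> by (simp add: dist_norm norm_minus_commute)
  ultimately have "?F' = (\<lambda>e. 0)"
    by (intro differential_zero_maxmin[of x "ball xbar \<rho>" ?F]) auto
  then show ?thesis by (metis eq_iff_diff_eq_0)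
qed

lemma continuous_on_c: "continuous_on S c"
  using has_derivative_continuous[OF c] continuous_at_imp_continuous_on by blast

lemma augmented_minimizer:
  assumes "\<rho> > 0"
  obtains x v where "norm (x - xbar) \<le> \<rho>" "norm (v - c xbar) \<le> \<rho>" "v \<in> domain h"
    "\<And>x' v'. norm (x' - xbar) \<le> \<rho> \<Longrightarrow> norm (v' - c xbar) \<le> \<rho> \<Longrightarrow> v' \<in> domain h \<Longrightarrow>
      augmented y r x v - \<mu> * ((x - xbar) \<bullet> (x - xbar))
      \<le> augmented y r x' v' - \<mu> * ((x' - xbar) \<bullet> (x' - xbar))"
proof -
  define B where "B = cball xbar \<rho> \<times> (cball (c xbar) \<rho> \<inter> domain h)"
  define F where "F p = augmented y r (fst p) (snd p) - \<mu> * ((fst p - xbar) \<bullet> (fst p - xbar))" for p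
  have "compact B"
    unfolding B_def by (intro compact_Times compact_cball compact_Int_closed closed_domain)
  moreover have "(xbar, c xbar) \<in> B" using assms xbar by (simp add: B_def)
  moreover have "continuous_on B F"
    unfolding F_def augmented_def B_def
    by (intro continuous_intros continuous_on_compose2[OF continuous_on_H]
        continuous_on_compose2[OF continuous_on_c]) auto
  ultimately obtain p where p: "p \<in> B" "\<forall>q\<in>B. F p \<le> F q"
    using continuous_attains_inf[of B F] by blast
  show ?thesis
  proof (rule that[of "fst p" "snd p"])
    fix x' v' assume *: "norm (x' - xbar) \<le> \<rho>" "norm (v' - c xbar) \<le> \<rho>" "v' \<in> domain h"
    then have "(x', v') \<in> B"
      by (simp add: B_def dist_norm norm_minus_commute)
    then show "augmented y r (fst p) (snd p) - \<mu> * ((fst p - xbar) \<bullet> (fst p - xbar))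
        \<le> augmented y r x' v' - \<mu> * ((x' - xbar) \<bullet> (x' - xbar))"
      using p(2) by (force simp: F_def)
  qed (use p(1) in \<open>auto simp: B_def dist_norm norm_minus_commute mem_Times_iff\<close>)
qed

text \<open>Minimisers of the tilted augmented Lagrangian over a small box converge to
  \<open>(xbar, c xbar)\<close> as \<open>r \<rightarrow> \<infinity>\<close>; they are KKT points up to a residual that is a small multiple
  of their distance from \<open>(xbar, ybar)\<close>, so subregularity puts them exactly at
  \<open>(xbar, c xbar)\<close>.\<close>

lemma augmented_growth:
  assumes M: "multipliers h c xbar = {ybar}"
    and sub: "\<And>x y v. y \<in> subdifferential h v \<Longrightarrow> norm (x - xbar, y - ybar) < \<delta> \<Longrightarrow>
      norm (x - xbar, y - ybar) \<le> \<kappa> * kkt_residual x y v"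
    and pos: "\<kappa> > 0" "\<delta> > 0" "\<gamma> > 0" "\<rho>0 > 0"
    and growth: "\<And>x. norm (x - xbar) < \<rho>0 \<Longrightarrow> c x \<in> domain h \<Longrightarrow>
      H (c xbar) + \<gamma> * (norm (x - xbar))\<^sup>2 \<le> H (c x)"
  shows "\<exists>r \<mu> \<rho>. \<mu> > 0 \<and> \<rho> > 0 \<and> (\<forall>x v. norm (x - xbar) \<le> \<rho> \<longrightarrow> norm (v - c xbar) \<le> \<rho> \<longrightarrow>
      v \<in> domain h \<longrightarrow> H (c xbar) + \<mu> * ((x - xbar) \<bullet> (x - xbar)) \<le> augmented ybar r x v)"
proof -
  \<comment> \<open>The first bound puts \<mu> below the growth constant, which places the limit at
    \<open>xbar\<close>; the second lets the tilt use up at most a quarter of the distance in the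
    subregularity estimate.\<close>
  define \<mu> where "\<mu> = min (\<gamma> / 2) (1 / (8 * \<kappa>))"
  \<comment> \<open>Growth holds on the open ball of radius \<open>\<rho>0\<close>, while the
    minimisation runs over closed balls.\<close>
  define \<rho> where "\<rho> = \<rho>0 / 2"
  have \<mu>: "\<mu> > 0" "\<mu> < \<gamma>" "2 * \<mu> * \<kappa> \<le> 1/4"
    using pos by (auto simp: \<mu>_def min_def field_simps)
  have \<rho>: "\<rho> > 0" "\<rho> < \<rho>0" using pos by (auto simp: \<rho>_def)
  have ybar: "ybar \<in> subdifferential h (c xbar)" "ybar \<in> multipliers h c xbar"
    using M multipliers_iff by auto
  define F where "F n x v = augmented ybar (real n) x v - \<mu> * ((x - xbar) \<bullet> (x - xbar))" for n x v
  have "\<exists>x v. norm (x - xbar) \<le> \<rho> \<and> norm (v - c xbar) \<le> \<rho> \<and> v \<in> domain h \<and>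
      (\<forall>x' v'. norm (x' - xbar) \<le> \<rho> \<longrightarrow> norm (v' - c xbar) \<le> \<rho> \<longrightarrow> v' \<in> domain h \<longrightarrow> F n x v \<le> F n x' v')" for n
    unfolding F_def by (rule augmented_minimizer[OF \<rho>(1), of ybar "real n" \<mu>]) blast
  then obtain X0 V0 where XV0: "\<And>n. norm (X0 n - xbar) \<le> \<rho>" "\<And>n. norm (V0 n - c xbar) \<le> \<rho>"
    "\<And>n. V0 n \<in> domain h"
    and min0: "\<And>n x' v'. norm (x' - xbar) \<le> \<rho> \<Longrightarrow> norm (v' - c xbar) \<le> \<rho> \<Longrightarrow> v' \<in> domain h \<Longrightarrow>
      F n (X0 n) (V0 n) \<le> F n x' v'"
    by metis
  let ?B = "cball xbar \<rho> \<times> (cball (c xbar) \<rho> \<inter> domain h)"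
  have "compact ?B"
    by (intro compact_Times compact_cball compact_Int_closed closed_domain)
  moreover have "\<forall>n. (X0 n, V0 n) \<in> ?B"
    using XV0 by (simp add: dist_norm norm_minus_commute)
  ultimately have "\<exists>p\<in>?B. \<exists>s. strict_mono s \<and> ((\<lambda>n. (X0 n, V0 n)) \<circ> s) \<longlonglongrightarrow> p"
    unfolding compact_def by simp
  then obtain p s where p: "p \<in> ?B" and s: "strict_mono (s :: nat \<Rightarrow> nat)"
    and lim: "((\<lambda>n. (X0 n, V0 n)) \<circ> s) \<longlonglongrightarrow> p"
    by blast
  obtain xs vs where p_eq: "p = (xs, vs)" by (cases p)
  define X where "X n = X0 (s n)" for n
  define V where "V n = V0 (s n)" for n
  define r where "r n = real (s n)" for n
  have X: "X \<longlonglongrightarrow> xs" and V: "V \<longlonglongrightarrow> vs"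
    using tendsto_fst[OF lim] tendsto_snd[OF lim] by (simp_all add: o_def p_eq X_def[abs_def] V_def[abs_def])
  have Vdom: "V n \<in> domain h" for n by (simp add: V_def XV0)
  have Fmin: "augmented ybar (r n) (X n) (V n) - \<mu> * ((X n - xbar) \<bullet> (X n - xbar))
      \<le> augmented ybar (r n) x' v' - \<mu> * ((x' - xbar) \<bullet> (x' - xbar))"
    if "norm (x' - xbar) \<le> \<rho>" "norm (v' - c xbar) \<le> \<rho>" "v' \<in> domain h" for n x' v'
    using min0[OF that, of "s n"] by (simp add: F_def X_def V_def r_def)
  have Fle: "augmented ybar (r n) (X n) (V n) - \<mu> * ((X n - xbar) \<bullet> (X n - xbar)) \<le> H (c xbar)" for n
    using Fmin[of xbar "c xbar" n] \<rho>(1) xbar by (simp add: augmented_def)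
  have r_pos: "r n \<ge> 0" for n by (simp add: r_def)
  have r_top: "filterlim r at_top sequentially"
    unfolding r_def by (rule filterlim_compose[OF filterlim_real_sequentially filterlim_subseq[OF s]])
  have cX: "(\<lambda>n. c (X n)) \<longlonglongrightarrow> c xs" by (rule tendsto_c[OF X])
  \<comment> \<open>The penalty makes the limit feasible: \<open>ybar\<close> bounds
    \<open>H (V n)\<close> below, so r n |c (X n) - V n|^2 stays bounded.\<close>
  have "(c xs - vs) \<bullet> (c xs - vs) \<le> 0"
  proof (rule LIMSEQ_le)
    show "(\<lambda>n. (c (X n) - V n) \<bullet> (c (X n) - V n)) \<longlonglongrightarrow> (c xs - vs) \<bullet> (c xs - vs)"
      by (intro tendsto_intros cX V)
    have "(\<lambda>n. inverse (r n) * (2 * (\<mu> * ((X n - xbar) \<bullet> (X n - xbar)) - ybar \<bullet> (c (X n) - c xbar))))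
        \<longlonglongrightarrow> 0 * (2 * (\<mu> * ((xs - xbar) \<bullet> (xs - xbar)) - ybar \<bullet> (c xs - c xbar)))"
      by (intro tendsto_intros cX X tendsto_inverse_0_at_top r_top)
    then show "(\<lambda>n. inverse (r n) * (2 * (\<mu> * ((X n - xbar) \<bullet> (X n - xbar)) - ybar \<bullet> (c (X n) - c xbar))))
        \<longlonglongrightarrow> 0" by simp
    have "\<forall>\<^sub>F n in sequentially. r n > 0"
      using r_top by (rule filterlim_at_top_dense[THEN iffD1, rule_format])
    then have "\<forall>\<^sub>F n in sequentially. (c (X n) - V n) \<bullet> (c (X n) - V n)
        \<le> inverse (r n) * (2 * (\<mu> * ((X n - xbar) \<bullet> (X n - xbar)) - ybar \<bullet> (c (X n) - c xbar)))"
    proof eventually_elim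
      case (elim n)
      have "H (c xbar) + ybar \<bullet> (V n - c xbar) \<le> H (V n)"
        using ybar(1) Vdom subdifferential_iff by blast
      then have "r n * ((c (X n) - V n) \<bullet> (c (X n) - V n))
          \<le> 2 * (\<mu> * ((X n - xbar) \<bullet> (X n - xbar)) - ybar \<bullet> (c (X n) - c xbar))"
        using Fle[of n] unfolding augmented_def by (simp add: inner_diff_right[of ybar])
      then have "inverse (r n) * (r n * ((c (X n) - V n) \<bullet> (c (X n) - V n)))
          \<le> inverse (r n) * (2 * (\<mu> * ((X n - xbar) \<bullet> (X n - xbar)) - ybar \<bullet> (c (X n) - c xbar)))"
        using elim by (intro mult_left_mono) auto
      moreover have "inverse (r n) * (r n * ((c (X n) - V n) \<bullet> (c (X n) - V n)))
          = (c (X n) - V n) \<bullet> (c (X n) - V n)"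
        using elim by simp
      ultimately show ?case by (simp only:)
    qed
    then show "\<exists>N. \<forall>n\<ge>N. (c (X n) - V n) \<bullet> (c (X n) - V n)
        \<le> inverse (r n) * (2 * (\<mu> * ((X n - xbar) \<bullet> (X n - xbar)) - ybar \<bullet> (c (X n) - c xbar)))"
      unfolding eventually_sequentially .
  qed
  then have vs: "vs = c xs" using inner_ge_zero[of "c xs - vs"] by (simp add: antisym)
  have vs_dom: "vs \<in> domain h" and xs_near: "norm (xs - xbar) \<le> \<rho>"
    using p by (auto simp: p_eq dist_norm norm_minus_commute)
  have HV: "(\<lambda>n. H (V n)) \<longlonglongrightarrow> H vs"
    by (rule continuous_on_tendsto_compose[OF continuous_on_H V vs_dom]) (use Vdom in auto)
  \<comment> \<open>Drop the nonnegative penalty and pass to the limit; growth with \<gamma> > \<mu>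
    then leaves only \<open>xs = xbar\<close>.\<close>
  have "H vs + ybar \<bullet> (c xs - vs) - \<mu> * ((xs - xbar) \<bullet> (xs - xbar)) \<le> H (c xbar)"
  proof (rule LIMSEQ_le_const2)
    show "(\<lambda>n. H (V n) + ybar \<bullet> (c (X n) - V n) - \<mu> * ((X n - xbar) \<bullet> (X n - xbar)))
        \<longlonglongrightarrow> H vs + ybar \<bullet> (c xs - vs) - \<mu> * ((xs - xbar) \<bullet> (xs - xbar))"
      by (intro tendsto_intros HV cX X V)
    have "H (V n) + ybar \<bullet> (c (X n) - V n) - \<mu> * ((X n - xbar) \<bullet> (X n - xbar)) \<le> H (c xbar)" for n
    proof -
      have "0 \<le> r n / 2 * ((c (X n) - V n) \<bullet> (c (X n) - V n))" using r_pos by simp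
      then show ?thesis using Fle[of n] unfolding augmented_def by linarith
    qed
    then show "\<exists>N. \<forall>n\<ge>N. H (V n) + ybar \<bullet> (c (X n) - V n) - \<mu> * ((X n - xbar) \<bullet> (X n - xbar)) \<le> H (c xbar)" by blast
  qed
  moreover have "H (c xbar) + \<gamma> * ((xs - xbar) \<bullet> (xs - xbar)) \<le> H (c xs)"
    using growth[of xs] xs_near \<rho> vs vs_dom by (simp add: power2_norm_eq_inner)
  ultimately have "(\<gamma> - \<mu>) * ((xs - xbar) \<bullet> (xs - xbar)) \<le> 0"
    by (simp add: vs left_diff_distrib)
  then have "(xs - xbar) \<bullet> (xs - xbar) \<le> 0" using \<mu> by (simp add: mult_le_0_iff)
  then have xs: "xs = xbar" using inner_ge_zero[of "xs - xbar"] by (simp add: antisym)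
  have X: "X \<longlonglongrightarrow> xbar" and V: "V \<longlonglongrightarrow> c xbar" using X V by (simp_all add: xs vs)
  define Y where "Y n = ybar + r n *\<^sub>R (c (X n) - V n)" for n
  define \<epsilon> where "\<epsilon> = min \<rho> (\<delta> / 2)"
  have \<epsilon>: "\<epsilon> > 0" using \<rho> pos by (simp add: \<epsilon>_def)
  have near: "\<forall>\<^sub>F n in sequentially. norm (X n - xbar) < \<epsilon> \<and> norm (V n - c xbar) < \<epsilon> \<and> 4 * \<kappa> < r n"
    using tendstoD[OF X \<epsilon>] tendstoD[OF V \<epsilon>] r_top[unfolded filterlim_at_top_dense, rule_format, of "4 * \<kappa>"]
    by eventually_elim (simp add: dist_norm)
  then obtain N where N: "\<And>n. n \<ge> N \<Longrightarrow> norm (X n - xbar) < \<epsilon> \<and> norm (V n - c xbar) < \<epsilon> \<and> 4 * \<kappa> < r n"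
    unfolding eventually_sequentially by blast
  have Ysub: "Y n \<in> subdifferential h (V n)" if "n \<ge> N" for n
    unfolding Y_def
  proof (rule augmented_stationary_v[OF Vdom])
    show "norm (V n - c xbar) < \<rho>" using N[OF that] by (simp add: \<epsilon>_def)
    fix v' assume "v' \<in> domain h" "norm (v' - c xbar) \<le> \<rho>"
    moreover have "norm (X n - xbar) \<le> \<rho>" using N[OF that] by (simp add: \<epsilon>_def)
    ultimately show "augmented ybar (r n) (X n) (V n) \<le> augmented ybar (r n) (X n) v'"
      using Fmin[of "X n" v' n] by simp
  qed
  have Ystat: "Y n \<bullet> c' (X n) e = 2 * \<mu> * ((X n - xbar) \<bullet> e)" if "n \<ge> N" for n e
    unfolding Y_def
  proof (rule augmented_stationary_x)
    show "norm (X n - xbar) < \<rho>" using N[OF that] by (simp add: \<epsilon>_def)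
    fix x' assume "norm (x' - xbar) \<le> \<rho>"
    moreover have "norm (V n - c xbar) \<le> \<rho>" using N[OF that] by (simp add: \<epsilon>_def)
    ultimately show "augmented ybar (r n) (X n) (V n) - \<mu> * ((X n - xbar) \<bullet> (X n - xbar))
        \<le> augmented ybar (r n) x' (V n) - \<mu> * ((x' - xbar) \<bullet> (x' - xbar))"
      using Fmin[of x' "V n" n] Vdom by simp
  qed
  \<comment> \<open>Otherwise the \<open>Y n\<close> would produce a second multiplier. One index
    with \<open>Y n\<close> in the range of subregularity suffices; its \<open>r n\<close> becomes
    the penalty parameter.\<close>
  have "\<exists>n\<ge>N. norm (Y n - ybar) < \<delta> / 2"
  proof (rule ccontr)
    assume "\<not> ?thesis"
    then have far: "\<delta> / 2 \<le> norm (Y (n + N) - ybar)" for n by (meson le_add2 not_le)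
    have "\<exists>y\<in>multipliers h c xbar. y \<noteq> ybar"
    proof (rule another_multiplier[OF ybar(2), of "\<lambda>n. X (n + N)" "\<lambda>n. V (n + N)" "\<lambda>n. Y (n + N)"])
      show "(\<lambda>n. X (n + N)) \<longlonglongrightarrow> xbar" "(\<lambda>n. V (n + N)) \<longlonglongrightarrow> c xbar"
        by (intro LIMSEQ_ignore_initial_segment X V)+
      show "Y (n + N) \<in> subdifferential h (V (n + N))" for n by (rule Ysub) simp
      show "(\<lambda>n. Y (n + N) \<bullet> c' (X (n + N)) e) \<longlonglongrightarrow> 0" for e
      proof -
        have "(\<lambda>n. 2 * \<mu> * ((X (n + N) - xbar) \<bullet> e)) \<longlonglongrightarrow> 2 * \<mu> * ((xbar - xbar) \<bullet> e)"
          by (intro tendsto_intros LIMSEQ_ignore_initial_segment X)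
        then show ?thesis by (simp add: Ystat)
      qed
      show "0 < \<delta> / 2" using pos by simp
      show "\<delta> / 2 \<le> norm (Y (n + N) - ybar)" for n by (rule far)
    qed
    then show False using M by simp
  qed
  then obtain n where n: "n \<ge> N" "norm (Y n - ybar) < \<delta> / 2" by blast
  have rn: "r n > 4 * \<kappa>" "r n > 0" using N[OF n(1)] pos by auto
  let ?z = "norm (X n - xbar, Y n - ybar)"
  have "?z \<le> norm (X n - xbar) + norm (Y n - ybar)" by (rule norm_Pair_le)
  then have "?z < \<delta>" using n N[OF n(1)] by (simp add: \<epsilon>_def)
  then have 1: "?z \<le> \<kappa> * kkt_residual (X n) (Y n) (V n)" by (rule sub[OF Ysub[OF n(1)]])
  have J: "transpose (jacobian c (at (X n))) *v Y n = (2 * \<mu>) *\<^sub>R (X n - xbar)"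
  proof -
    have "(transpose (jacobian c (at (X n))) *v Y n) \<bullet> e = ((2 * \<mu>) *\<^sub>R (X n - xbar)) \<bullet> e" for e
      unfolding transpose_jacobian_inner[OF c] using Ystat[OF n(1)] by simp
    then show ?thesis by (metis vector_eq_rdot)
  qed
  have Vn: "V n - c (X n) = - inverse (r n) *\<^sub>R (Y n - ybar)"
    using rn by (simp add: Y_def)
  have "kkt_residual (X n) (Y n) (V n) \<le> norm ((2 * \<mu>) *\<^sub>R (X n - xbar)) + norm (V n - c (X n))"
    unfolding kkt_residual_def J by (rule norm_Pair_le)
  also have "\<dots> = 2 * \<mu> * norm (X n - xbar) + inverse (r n) * norm (Y n - ybar)"
    using \<mu> rn unfolding Vn by simp
  also have "\<dots> \<le> 2 * \<mu> * ?z + inverse (r n) * ?z"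
    using \<mu> rn by (intro add_mono mult_left_mono norm_fst_snd_le) auto
  finally have "\<kappa> * kkt_residual (X n) (Y n) (V n) \<le> \<kappa> * (2 * \<mu> * ?z + inverse (r n) * ?z)"
    using pos by (intro mult_left_mono) auto
  also have "\<dots> = (2 * \<mu> * \<kappa>) * ?z + (\<kappa> / r n) * ?z" by (simp add: field_simps)
  \<comment> \<open>One quarter comes from the choice of \<mu>, the other from r n > 4 \<kappa>; the
    distance is then at most half of itself.\<close>
  also have "\<dots> \<le> 1/4 * ?z + 1/4 * ?z"
    using \<mu> rn pos by (intro add_mono mult_right_mono) (auto simp: field_simps)
  finally have "?z = 0" using 1 norm_ge_zero[of "(X n - xbar, Y n - ybar)"] by linarith
  then have Xn: "X n = xbar" and Yn: "Y n = ybar" by (simp_all add: zero_prod_def)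
  have "V n = c xbar" using Vn by (simp add: Xn Yn)
  \<comment> \<open>Minimality at (xbar, c xbar), where the minimised function has the value
    \<open>H (c xbar)\<close>, is the claimed growth.\<close>
  then have "H (c xbar) + \<mu> * ((x - xbar) \<bullet> (x - xbar)) \<le> augmented ybar (r n) x v"
    if "norm (x - xbar) \<le> \<rho>" "norm (v - c xbar) \<le> \<rho>" "v \<in> domain h" for x v
    using Fmin[OF that, of n] by (simp add: Xn augmented_def)
  then show ?thesis using \<mu>(1) \<rho>(1) by blast
qed

lemma second_order_of_augmented_growth:
  assumes M: "multipliers h c xbar = {ybar}" and pos: "\<mu> > 0" "\<rho> > 0"
    and growth: "\<And>x v. norm (x - xbar) \<le> \<rho> \<Longrightarrow> norm (v - c xbar) \<le> \<rho> \<Longrightarrow> v \<in> domain h \<Longrightarrow>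
      H (c xbar) + \<mu> * ((x - xbar) \<bullet> (x - xbar)) \<le> augmented ybar r x v"
  shows "second_order_positive ybar"
  unfolding second_order_positive_def
proof (intro allI impI, elim conjE)
  fix d k s
  assume d: "d \<noteq> 0" and crit: "piece_gradient k (c xbar) \<bullet> c' xbar d \<le> 0"
    and k: "k < K" "c xbar \<in> C k" "c xbar + s *\<^sub>R c' xbar d \<in> C k" and s: "0 < s"
  let ?w = "c' xbar d"
  let ?q = "?w \<bullet> (Q k *v ?w)"
  have ybar: "ybar \<in> subdifferential h (c xbar)" "\<And>e. ybar \<bullet> c' xbar e = 0"
    using M multipliers_iff by auto
  have "ybar \<bullet> (s *\<^sub>R ?w) \<le> piece_gradient k (c xbar) \<bullet> (s *\<^sub>R ?w)"
    using subgradient_le_piece_gradient[OF ybar(1) k] by simp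
  \<comment> \<open>\<open>ybar\<close> annihilates \<open>?w\<close> and bounds the slope from
    below, so a critical direction has slope exactly 0 and \<open>H\<close> changes only at second
    order along it.\<close>
  then have crit0: "piece_gradient k (c xbar) \<bullet> ?w = 0"
    using s crit ybar(2) by (auto simp: zero_le_mult_iff)
  define T where "T n = inverse (real (Suc n))" for n
  define A where "A n = (1 / (T n)\<^sup>2) *\<^sub>R (c (xbar + T n *\<^sub>R d) - c xbar - c' xbar (xbar + T n *\<^sub>R d - xbar))" for n
  have T: "T n > 0" for n by (simp add: T_def)
  have T0: "T \<longlonglongrightarrow> 0" unfolding T_def by (rule LIMSEQ_inverse_real_of_nat)
  have XT: "(\<lambda>n. xbar + T n *\<^sub>R d) \<longlonglongrightarrow> xbar"
    using tendsto_add[OF tendsto_const tendsto_scaleR[OF T0 tendsto_const], of xbar d] by simp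
  have WT: "(\<lambda>n. c xbar + T n *\<^sub>R ?w) \<longlonglongrightarrow> c xbar"
    using tendsto_add[OF tendsto_const tendsto_scaleR[OF T0 tendsto_const], of "c xbar" ?w] by simp
  have "(\<lambda>n. (1 / T n) *\<^sub>R (xbar + T n *\<^sub>R d - xbar)) \<longlonglongrightarrow> d"
    using T by (simp add: less_imp_neq[symmetric])
  then have A: "A \<longlonglongrightarrow> (1/2) *\<^sub>R c'' d d"
    unfolding A_def by (rule second_order_seq_quotient[OF c c' XT T])
  \<comment> \<open>After division by (T n)^2 the penalty keeps a factor (T n)^2; the last summand
    is its vanishing limit.\<close>
  have "\<mu> * (d \<bullet> d) \<le> ?q / 2 + ybar \<bullet> ((1/2) *\<^sub>R c'' d d)
      + r/2 * (0\<^sup>2 * (((1/2) *\<^sub>R c'' d d) \<bullet> ((1/2) *\<^sub>R c'' d d)))"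
  proof (rule tendsto_lowerbound)
    show "(\<lambda>n. ?q / 2 + ybar \<bullet> A n + r/2 * ((T n)\<^sup>2 * (A n \<bullet> A n))) \<longlonglongrightarrow>
        ?q / 2 + ybar \<bullet> ((1/2) *\<^sub>R c'' d d) + r/2 * (0\<^sup>2 * (((1/2) *\<^sub>R c'' d d) \<bullet> ((1/2) *\<^sub>R c'' d d)))"
      by (intro tendsto_intros A T0)
    show "\<forall>\<^sub>F n in sequentially. \<mu> * (d \<bullet> d) \<le> ?q / 2 + ybar \<bullet> A n + r/2 * ((T n)\<^sup>2 * (A n \<bullet> A n))"
      using tendstoD[OF XT pos(2)] tendstoD[OF WT pos(2)] order_tendstoD(2)[OF T0 s]
    proof eventually_elim
      case (elim n)
      have t: "0 \<le> T n" "T n \<le> s" using T[of n] elim by auto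
      have v: "c xbar + T n *\<^sub>R ?w \<in> domain h"
        using H_ray(1)[OF k s t] piece_subset_domain[OF k(1)] by blast
      have Hv: "H (c xbar + T n *\<^sub>R ?w) = H (c xbar) + (T n)\<^sup>2 * (?q / 2)"
        using H_ray(2)[OF k s t] crit0 by simp
      have diff: "c (xbar + T n *\<^sub>R d) - (c xbar + T n *\<^sub>R ?w) = (T n)\<^sup>2 *\<^sub>R A n"
        using T[of n] by (simp add: A_def blinfun.scaleR_right)
      have "H (c xbar) + \<mu> * ((T n *\<^sub>R d) \<bullet> (T n *\<^sub>R d))
          \<le> augmented ybar r (xbar + T n *\<^sub>R d) (c xbar + T n *\<^sub>R ?w)"
        using growth[of "xbar + T n *\<^sub>R d" "c xbar + T n *\<^sub>R ?w"] elim v by (simp add: dist_norm)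
      then have "(T n)\<^sup>2 * (\<mu> * (d \<bullet> d))
          \<le> (T n)\<^sup>2 * (?q / 2 + ybar \<bullet> A n + r/2 * ((T n)\<^sup>2 * (A n \<bullet> A n)))"
        unfolding augmented_def diff Hv by (simp add: power2_eq_square algebra_simps)
      then show ?case by (rule mult_left_le_imp_le[OF _ zero_less_power[OF T]])
    qed
  qed simp
  moreover have "\<mu> * (d \<bullet> d) > 0" using pos d by simp
  ultimately show "0 < ?q + ybar \<bullet> c'' d d" by simp
qed

end

section \<open>Translation of the definitions and the equivalence\<close>

lemma plq_imp_convex_plq:
  assumes "plq h" "econvex h"
  obtains K C Q b \<beta> where "convex_plq h K C Q b \<beta>"
proof -
  obtain K :: nat and C Q b \<beta> where "domain h = (\<Union>k<K. C k)"
    "\<forall>k<K. polyhedron (C k) \<and> transpose (Q k) = Q k \<and>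
      (\<forall>c\<in>C k. h c = ereal (1/2 * (c \<bullet> (Q k *v c)) + b k \<bullet> c + \<beta> k))"
    using assms(1) unfolding plq_def by metis
  then have "convex_plq h K C Q b \<beta>"
    using assms unfolding plq_def by unfold_locales auto
  then show ?thesis by (rule that)
qed

context composite_plq
begin

lemma zero_mem_kkt_iff:
  "0 \<in> {kkt_g c (xbar, ybar) + w | w. w \<in> kkt_G h (xbar, ybar)} \<longleftrightarrow> ybar \<in> multipliers h c xbar"
proof -
  have "0 \<in> {kkt_g c (xbar, ybar) + w | w. w \<in> kkt_G h (xbar, ybar)} \<longleftrightarrow>
      transpose (jacobian c (at xbar)) *v ybar = 0 \<and> c xbar \<in> subdifferential (conjugate h) ybar"
    unfolding kkt_g_def kkt_G_def by (auto simp: zero_prod_def)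
  then show ?thesis
    unfolding multipliers_def null_space_def subdifferential_conjugate by auto
qed

text \<open>Inverting the conjugate's subdifferential parametrises the values of g + G by the points
  \<open>v\<close>. If there are none, both sides are \<infinity>.\<close>

lemma kkt_distance:
  "edist_set 0 {kkt_g c (x, y) + w | w. w \<in> kkt_G h (x, y)}
    = (INF v\<in>{v. y \<in> subdifferential h v}. ereal (kkt_residual x y v))"
proof -
  have "{kkt_g c (x, y) + w | w. w \<in> kkt_G h (x, y)}
      = (\<lambda>v. (transpose (jacobian c (at x)) *v y, v - c x)) ` {v. y \<in> subdifferential h v}"
    unfolding kkt_g_def kkt_G_def using subdifferential_conjugate by (auto simp: image_iff)
  then show ?thesis
    unfolding edist_set_def kkt_residual_def by (simp add: image_image dist_norm)
qed

lemma strongly_subregular_iff: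
  "strongly_metrically_subregular (\<lambda>z. {kkt_g c z + w | w. w \<in> kkt_G h z}) (xbar, ybar) 0 \<longleftrightarrow>
    ybar \<in> multipliers h c xbar \<and>
    (\<exists>\<kappa>>0. \<exists>\<delta>>0. \<forall>x y v. y \<in> subdifferential h v \<longrightarrow> norm (x - xbar, y - ybar) < \<delta> \<longrightarrow>
      norm (x - xbar, y - ybar) \<le> \<kappa> * kkt_residual x y v)"
  (is "?S \<longleftrightarrow> ?M \<and> ?R")
proof
  assume S: ?S
  then obtain \<kappa> U where \<kappa>: "\<kappa> \<ge> 0" and U: "open U" "(xbar, ybar) \<in> U"
    and le: "\<And>z. z \<in> U \<Longrightarrow> ereal (norm (z - (xbar, ybar)))
      \<le> ereal \<kappa> * edist_set 0 {kkt_g c z + w | w. w \<in> kkt_G h z}"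
    unfolding strongly_metrically_subregular_def by blast
  obtain \<delta> where \<delta>: "\<delta> > 0" "ball (xbar, ybar) \<delta> \<subseteq> U" using U open_contains_ball by blast
  \<comment> \<open>The definition admits \<kappa> = 0, whereas a positive modulus is
    wanted.\<close>
  have "norm (x - xbar, y - ybar) \<le> (\<kappa> + 1) * kkt_residual x y v"
    if y: "y \<in> subdifferential h v" and near: "norm (x - xbar, y - ybar) < \<delta>" for x y v
  proof -
    have "dist (x, y) (xbar, ybar) < \<delta>" using near by (simp add: dist_norm)
    then have "(x, y) \<in> ball (xbar, ybar) \<delta>" by (simp add: dist_commute)
    then have "(x, y) \<in> U" using \<delta>(2) by blast
    then have "ereal (norm (x - xbar, y - ybar))
        \<le> ereal \<kappa> * (INF v\<in>{v. y \<in> subdifferential h v}. ereal (kkt_residual x y v))"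
      using le[of "(x, y)"] unfolding kkt_distance by simp
    also have "\<dots> \<le> ereal \<kappa> * ereal (kkt_residual x y v)"
      using y \<kappa> by (intro ereal_mult_left_mono INF_lower) auto
    finally have "norm (x - xbar, y - ybar) \<le> \<kappa> * kkt_residual x y v" by simp
    also have "\<dots> \<le> (\<kappa> + 1) * kkt_residual x y v"
      by (intro mult_right_mono) (auto simp: kkt_residual_def)
    finally show ?thesis .
  qed
  moreover have "\<kappa> + 1 > 0" using \<kappa> by simp
  ultimately have ?R using \<delta>(1) by blast
  moreover have ?M
    using S zero_mem_kkt_iff unfolding strongly_metrically_subregular_def by blast
  ultimately show "?M \<and> ?R" by simp
next
  assume "?M \<and> ?R"
  then obtain \<kappa> \<delta> where M: ?M and pos: "\<kappa> > 0" "\<delta> > 0"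
    and le: "\<And>x y v. y \<in> subdifferential h v \<Longrightarrow> norm (x - xbar, y - ybar) < \<delta> \<Longrightarrow>
      norm (x - xbar, y - ybar) \<le> \<kappa> * kkt_residual x y v"
    by blast
  have "ereal (norm (z - (xbar, ybar))) \<le> ereal \<kappa> * edist_set 0 {kkt_g c z + w | w. w \<in> kkt_G h z}"
    if z: "z \<in> ball (xbar, ybar) \<delta>" for z
  proof -
    obtain x y where z_eq: "z = (x, y)" by (cases z)
    have "dist (x, y) (xbar, ybar) < \<delta>" using z by (simp add: z_eq dist_commute)
    then have near: "norm (x - xbar, y - ybar) < \<delta>" by (simp add: dist_norm)
    \<comment> \<open>Divided by \<kappa>, the estimate is a lower bound for every residual and
      hence for the infimum, also over an empty index set.\<close>
    have "ereal (norm (x - xbar, y - ybar) / \<kappa>)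
        \<le> (INF v\<in>{v. y \<in> subdifferential h v}. ereal (kkt_residual x y v))"
      using le[OF _ near] pos by (intro INF_greatest) (auto simp: field_simps)
    then have "ereal \<kappa> * ereal (norm (x - xbar, y - ybar) / \<kappa>)
        \<le> ereal \<kappa> * (INF v\<in>{v. y \<in> subdifferential h v}. ereal (kkt_residual x y v))"
      using pos by (intro ereal_mult_left_mono) auto
    then show ?thesis unfolding z_eq kkt_distance using pos by simp
  qed
  then have "\<exists>\<kappa>\<ge>0. \<exists>U. open U \<and> (xbar, ybar) \<in> U \<and> (\<forall>z\<in>U. ereal (norm (z - (xbar, ybar)))
      \<le> ereal \<kappa> * edist_set 0 {kkt_g c z + w | w. w \<in> kkt_G h z})"
    using pos by (intro exI[of _ \<kappa>] conjI exI[of _ "ball (xbar, ybar) \<delta>"]) auto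
  then show ?S
    using M zero_mem_kkt_iff unfolding strongly_metrically_subregular_def by blast
qed

lemma strong_local_minimizer_iff:
  "strong_local_minimizer (h \<circ> c) xbar \<longleftrightarrow>
    (\<exists>\<gamma>>0. \<exists>\<delta>>0. \<forall>x. norm (x - xbar) < \<delta> \<longrightarrow> c x \<in> domain h \<longrightarrow>
      H (c xbar) + \<gamma> * (norm (x - xbar))\<^sup>2 \<le> H (c x))"
  (is "?S \<longleftrightarrow> ?R")
proof -
  have dom: "x \<in> domain (h \<circ> c) \<longleftrightarrow> c x \<in> domain h" for x by (simp add: domain_def)
  have val: "(h \<circ> c) xbar + ereal (\<gamma> * (norm (x - xbar))\<^sup>2) \<le> (h \<circ> c) x \<longleftrightarrow>
      H (c xbar) + \<gamma> * (norm (x - xbar))\<^sup>2 \<le> H (c x)" if "c x \<in> domain h" for x \<gamma>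
    using h_eq[OF xbar] h_eq[OF that] by simp
  show ?thesis
  proof
    assume ?S
    then obtain U \<gamma> where \<gamma>: "\<gamma> > 0" and U: "open U" "xbar \<in> U" and
      le: "\<And>x. x \<in> U \<Longrightarrow> x \<in> domain (h \<circ> c) \<Longrightarrow>
        (h \<circ> c) xbar + ereal (\<gamma> * (norm (x - xbar))\<^sup>2) \<le> (h \<circ> c) x"
      unfolding strong_local_minimizer_def by blast
    obtain \<delta> where \<delta>: "\<delta> > 0" "ball xbar \<delta> \<subseteq> U" using U open_contains_ball by blast
    have "H (c xbar) + \<gamma> * (norm (x - xbar))\<^sup>2 \<le> H (c x)"
      if "norm (x - xbar) < \<delta>" "c x \<in> domain h" for x
    proof -
      have "x \<in> U" using \<delta>(2) that(1) by (auto simp: dist_norm norm_minus_commute)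
      then show ?thesis using le dom val that(2) by blast
    qed
    then show ?R using \<gamma> \<delta>(1) by blast
  next
    assume ?R
    then obtain \<gamma> \<delta> where pos: "\<gamma> > 0" "\<delta> > 0" and
      le: "\<And>x. norm (x - xbar) < \<delta> \<Longrightarrow> c x \<in> domain h \<Longrightarrow>
        H (c xbar) + \<gamma> * (norm (x - xbar))\<^sup>2 \<le> H (c x)"
      by blast
    have "(h \<circ> c) xbar + ereal (\<gamma> * (norm (x - xbar))\<^sup>2) \<le> (h \<circ> c) x"
      if "x \<in> ball xbar \<delta> \<inter> domain (h \<circ> c)" for x
    proof -
      have "c x \<in> domain h" "norm (x - xbar) < \<delta>"
        using that dom by (auto simp: dist_norm norm_minus_commute)
      then show ?thesis using le val by blast
    qed
    then show ?S
      unfolding strong_local_minimizer_def using pos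
      by (intro exI[of _ "ball xbar \<delta>"] exI[of _ \<gamma>]) auto
  qed
qed

text \<open>A second multiplier \<open>y\<close> would make the whole segment \<open>{xbar} \<times> [ybar, y]\<close> consist of
  solutions of the KKT system.\<close>

lemma multipliers_singleton_of_subregular:
  assumes ybar: "ybar \<in> multipliers h c xbar" and pos: "\<delta> > 0"
    and sub: "\<And>x y v. y \<in> subdifferential h v \<Longrightarrow> norm (x - xbar, y - ybar) < \<delta> \<Longrightarrow>
      norm (x - xbar, y - ybar) \<le> \<kappa> * kkt_residual x y v"
  shows "multipliers h c xbar = {ybar}"
proof (rule ccontr)
  assume "\<not> ?thesis"
  then obtain y where y: "y \<in> multipliers h c xbar" "y \<noteq> ybar" using ybar by blast
  \<comment> \<open>Keeps the new point on the segment and within distance \<delta> of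
    \<open>ybar\<close>.\<close>
  define t where "t = min 1 (\<delta> / (2 * norm (y - ybar)))"
  have t: "0 < t" "t \<le> 1" "t * norm (y - ybar) < \<delta>"
    using y(2) pos by (auto simp: t_def min_def field_simps)
  let ?y = "ybar + t *\<^sub>R (y - ybar)"
  have "?y \<in> subdifferential h (c xbar)"
    unfolding subdifferential_iff
  proof (intro conjI ballI xbar)
    fix z assume z: "z \<in> domain h"
    have 1: "H (c xbar) + y \<bullet> (z - c xbar) \<le> H z" "H (c xbar) + ybar \<bullet> (z - c xbar) \<le> H z"
      using y(1) ybar z unfolding multipliers_iff subdifferential_iff by auto
    have "t * (H (c xbar) + y \<bullet> (z - c xbar)) + (1 - t) * (H (c xbar) + ybar \<bullet> (z - c xbar))
        \<le> t * H z + (1 - t) * H z"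
      using t by (intro add_mono mult_left_mono 1) auto
    then show "H (c xbar) + ?y \<bullet> (z - c xbar) \<le> H z"
      by (simp add: inner_add_left inner_diff_left[of y ybar] algebra_simps)
  qed
  moreover have "?y \<bullet> c' xbar e = 0" for e
    using y(1) ybar by (simp add: multipliers_iff inner_add_left inner_diff_left)
  ultimately have m: "?y \<in> multipliers h c xbar" by (simp add: multipliers_iff)
  then have "kkt_residual xbar ?y (c xbar) = 0"
    unfolding kkt_residual_def multipliers_def null_space_def by (simp add: norm_Pair)
  moreover have "norm (xbar - xbar, ?y - ybar) < \<delta>" using t by (simp add: norm_Pair)
  ultimately have "norm (xbar - xbar, ?y - ybar) \<le> \<kappa> * 0"
    using sub[of ?y "c xbar" xbar] m by (simp add: multipliers_iff)
  then show False using t y(2) by (simp add: norm_Pair mult_le_0_iff)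
qed

lemma second_order_iff_subregular:
  "multipliers h c xbar = {ybar} \<and> second_order_sufficient h c xbar \<longleftrightarrow>
    strongly_metrically_subregular (\<lambda>z. {kkt_g c z + w | w. w \<in> kkt_G h z}) (xbar, ybar) 0 \<and>
    strong_local_minimizer (h \<circ> c) xbar"
proof
  assume L: "multipliers h c xbar = {ybar} \<and> second_order_sufficient h c xbar"
  then have "second_order_positive ybar" using second_order_sufficient_iff by blast
  then show "strongly_metrically_subregular (\<lambda>z. {kkt_g c z + w | w. w \<in> kkt_G h z}) (xbar, ybar) 0 \<and>
      strong_local_minimizer (h \<circ> c) xbar"
    unfolding strongly_subregular_iff strong_local_minimizer_iff
    using L subregular_of_second_order quadratic_growth_of_second_order by blast
next
  assume "strongly_metrically_subregular (\<lambda>z. {kkt_g c z + w | w. w \<in> kkt_G h z}) (xbar, ybar) 0 \<and>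
      strong_local_minimizer (h \<circ> c) xbar"
  then obtain \<kappa> \<delta> \<gamma> \<rho>0 where ybar: "ybar \<in> multipliers h c xbar"
    and pos: "\<kappa> > 0" "\<delta> > 0" "\<gamma> > 0" "\<rho>0 > 0"
    and sub: "\<And>x y v. y \<in> subdifferential h v \<Longrightarrow> norm (x - xbar, y - ybar) < \<delta> \<Longrightarrow>
      norm (x - xbar, y - ybar) \<le> \<kappa> * kkt_residual x y v"
    and growth: "\<And>x. norm (x - xbar) < \<rho>0 \<Longrightarrow> c x \<in> domain h \<Longrightarrow>
      H (c xbar) + \<gamma> * (norm (x - xbar))\<^sup>2 \<le> H (c x)"
    unfolding strongly_subregular_iff strong_local_minimizer_iff by blast
  \<comment> \<open>Uniqueness must come first: the augmented Lagrangian argument uses it to bring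
    the multiplier updates close to \<open>ybar\<close>.\<close>
  have M: "multipliers h c xbar = {ybar}"
    by (rule multipliers_singleton_of_subregular[OF ybar pos(2) sub])
  obtain r \<mu> \<rho> where "\<mu> > 0" "\<rho> > 0"
    and "\<And>x v. norm (x - xbar) \<le> \<rho> \<Longrightarrow> norm (v - c xbar) \<le> \<rho> \<Longrightarrow> v \<in> domain h \<Longrightarrow>
      H (c xbar) + \<mu> * ((x - xbar) \<bullet> (x - xbar)) \<le> augmented ybar r x v"
    using augmented_growth[OF M sub pos growth] by blast
  then have "second_order_positive ybar"
    by (rule second_order_of_augmented_growth[OF M])
  then show "multipliers h c xbar = {ybar} \<and> second_order_sufficient h c xbar"
    using M second_order_sufficient_iff by blast
qed

end

theorem theorem5p1:
  fixes h :: "real^'m \<Rightarrow> ereal" and c :: "real^'n \<Rightarrow> real^'m"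
    and f :: "real^'n \<Rightarrow> ereal" and xbar :: "real^'n" and ybar :: "real^'m"
  assumes "plq h" and "econvex h"
    and "C2_smooth c"
    and "f = h \<circ> c"
    and "xbar \<in> domain f"
    and "basic_cq h c xbar"
  shows "(multipliers h c xbar = {ybar} \<and> second_order_sufficient h c xbar) \<longleftrightarrow>
    (strongly_metrically_subregular (\<lambda>z. {kkt_g c z + w | w. w \<in> kkt_G h z}) (xbar, ybar) 0 \<and>
     strong_local_minimizer f xbar)"
proof -
  obtain K C Q b \<beta> where h: "convex_plq h K C Q b \<beta>"
    using plq_imp_convex_plq assms(1,2) by blast
  obtain c' c'' where c: "\<And>x. (c has_derivative blinfun_apply (c' x)) (at x)"
    "\<And>x. (c' has_derivative blinfun_apply (c'' x)) (at x)"
    using assms(3) unfolding C2_smooth_def by blast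
  have "c xbar \<in> domain h" using assms(4,5) by (simp add: domain_def)
  then interpret composite_plq h K C Q b \<beta> c c' "c'' xbar" xbar
    by (intro composite_plq.intro composite_plq_axioms.intro h c)
  show ?thesis unfolding assms(4) by (rule second_order_iff_subregular)
qed

end
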